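(* For every partition $\lambda$, with respect to the order $<_2$, \[ \sum_{\sigma\ \Phi\text{-degenerate}}(-1)^{m(\sigma)}q^{p(\sigma)+\mathrm{maj}(\sigma)}t^{\mathrm{quinv}(\sigma)}x^{|\sigma|}=0, \] the sum being over all $\Phi$-degenerate super fillings of $\mathrm{dg}(\lambda)$.
   Context: Let $\lambda=(\lambda_1\ge\dots\ge\lambda_k>0)$ be a partition; $\mathrm{dg}(\lambda)=\{(r,i):1\le i\le k,1\le r\le\lambda_i\}$, $(r,i)$ being row $r$ from the bottom and column $i$ from the left (columns bottom-justified of heights $\lambda_i$); $\mathrm{leg}((r,i))=\lambda_i-r$. $\mathcal A=\{1,\bar1,2,\bar2,\dots\}$ consists of positive letters $i$ and negative letters $\bar i$, $|i|=|\bar i|=i$, totally ordered by $<_2$: $0<1<2<3<\cdots<\bar3<\bar2<\bar1$. $I(a,b)=1$ if $a>b$ or $a=b$ is negative, and $I(a,b)=0$ if $a<b$ or $a=b$ is positive. A super filling is $\sigma:\mathrm{dg}(\lambda)\to\mathcal A$; a cell $u=(r,i)$, $r>1$, is a descent if $I(\sigma(u),\sigma((r-1,i)))=1$, and $\mathrm{maj}(\sigma)=\sum_{\text{descents }u}(\mathrm{leg}(u)+1)$. A triple is either three cells $(r+1,i),(r,i),(r,j)$ with $i<j$, or (degenerate) two cells $(r,i),(r,j)$ with $i<j$ and $\lambda_i=r$; with $a=\sigma((r+1,i))$ ($a=0$ if degenerate), $b=\sigma((r,i))$, $c=\sigma((r,j))$, it is a quinv triple iff exactly one of $I(a,b)=1$,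 $I(c,b)=0$, $I(a,c)=0$ holds; $\mathrm{quinv}(\sigma)$ is their number. $x^{|\sigma|}=\prod_u x_{|\sigma(u)|}$; $p(\sigma),m(\sigma)$ are the numbers of positive, resp. negative, entries. The reading order goes through rows top to bottom, each row right to left. The distinguished label of $\sigma$ is the smallest positive integer $a$ such that some cell $(r,j)$ has $|\sigma((r,j))|=a$ and $r>a$; the distinguished cell is the first cell in reading order whose entry has absolute value $a$; $\sigma$ is $\Phi$-degenerate if $a$ exists and the distinguished cell belongs to some degenerate triple. *)

theory Defs
  imports Main "HOL-Library.Multiset"
begin

text \<open>Letters of the super alphabet, plus the auxiliary letter Zero (the value 0
  used for the missing top cell of a degenerate triple).  Pos n is the positive
  letter n, Neg n the negative letter bar n (n \<ge> 1 for genuine letters).\<close>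
datatype letter = Zero | Pos nat | Neg nat

fun absv :: "letter \<Rightarrow> nat" where
  "absv Zero = 0" | "absv (Pos n) = n" | "absv (Neg n) = n"

fun is_pos :: "letter \<Rightarrow> bool" where
  "is_pos (Pos n) = True" | "is_pos _ = False"

fun is_neg :: "letter \<Rightarrow> bool" where
  "is_neg (Neg n) = True" | "is_neg _ = False"

fun lt2 :: "letter \<Rightarrow> letter \<Rightarrow> bool" where
  "lt2 Zero Zero = False"
| "lt2 Zero _ = True"
| "lt2 (Pos i) Zero = False"
| "lt2 (Pos i) (Pos j) = (i < j)"
| "lt2 (Pos i) (Neg j) = True"
| "lt2 (Neg i) Zero = False"
| "lt2 (Neg i) (Pos j) = False"
| "lt2 (Neg i) (Neg j) = (j < i)"

definition Ind :: "letter \<Rightarrow> letter \<Rightarrow> bool" where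
  "Ind a b \<longleftrightarrow> lt2 b a \<or> (a = b \<and> is_neg a)"

text \<open>Partitions as weakly decreasing lists of positive naturals;
  column i (1-based) has height lam ! (i-1).\<close>
definition is_partition :: "nat list \<Rightarrow> bool" where
  "is_partition lam \<longleftrightarrow> sorted_wrt (\<ge>) lam \<and> 0 \<notin> set lam"

definition ht :: "nat list \<Rightarrow> nat \<Rightarrow> nat" where
  "ht lam i = lam ! (i - 1)"

text \<open>Cells (r,i): row r from the bottom, column i from the left.\<close>
definition dg :: "nat list \<Rightarrow> (nat \<times> nat) set" where
  "dg lam = {(r, i). 1 \<le> i \<and> i \<le> length lam \<and> 1 \<le> r \<and> r \<le> ht lam i}"

definition leg :: "nat list \<Rightarrow> nat \<times> nat \<Rightarrow> nat" where
  "leg lam u = ht lam (snd u) - fst u"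

text \<open>Super fillings: maps from dg(lam) to genuine letters; extended by Zero
  outside the diagram so that they are unique functions.\<close>
definition super_filling :: "nat list \<Rightarrow> (nat \<times> nat \<Rightarrow> letter) \<Rightarrow> bool" where
  "super_filling lam \<sigma> \<longleftrightarrow>
     (\<forall>u \<in> dg lam. \<exists>n \<ge> 1. \<sigma> u = Pos n \<or> \<sigma> u = Neg n) \<and>
     (\<forall>u. u \<notin> dg lam \<longrightarrow> \<sigma> u = Zero)"

definition descent :: "nat list \<Rightarrow> (nat \<times> nat \<Rightarrow> letter) \<Rightarrow> nat \<times> nat \<Rightarrow> bool" where
  "descent lam \<sigma> u \<longleftrightarrow> u \<in> dg lam \<and> fst u > 1 \<and>
     Ind (\<sigma> u) (\<sigma> (fst u - 1, snd u))"

definition maj :: "nat list \<Rightarrow> (nat \<times> nat \<Rightarrow> letter) \<Rightarrow> nat" where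
  "maj lam \<sigma> = (\<Sum>u \<in> {u \<in> dg lam. descent lam \<sigma> u}. leg lam u + 1)"

text \<open>Triples, indexed by (r,i,j) with i < j and (r,i),(r,j) in the diagram:
  non-degenerate if (r+1,i) is in the diagram, degenerate if lam_i = r
  (then the top entry is a = 0, i.e. Zero).\<close>
definition triples :: "nat list \<Rightarrow> (nat \<times> nat \<times> nat) set" where
  "triples lam = {(r, i, j). i < j \<and> (r, i) \<in> dg lam \<and> (r, j) \<in> dg lam}"

definition quinv_triple :: "nat list \<Rightarrow> (nat \<times> nat \<Rightarrow> letter) \<Rightarrow> nat \<times> nat \<times> nat \<Rightarrow> bool" where
  "quinv_triple lam \<sigma> x = (case x of (r, i, j) \<Rightarrow>
     (let a = (if (r + 1, i) \<in> dg lam then \<sigma> (r + 1, i) else Zero);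
          b = \<sigma> (r, i); c = \<sigma> (r, j) in
      length (filter id [Ind a b, \<not> Ind c b, \<not> Ind a c]) = 1))"

definition quinv :: "nat list \<Rightarrow> (nat \<times> nat \<Rightarrow> letter) \<Rightarrow> nat" where
  "quinv lam \<sigma> = card {x \<in> triples lam. quinv_triple lam \<sigma> x}"

definition pcount :: "nat list \<Rightarrow> (nat \<times> nat \<Rightarrow> letter) \<Rightarrow> nat" where
  "pcount lam \<sigma> = card {u \<in> dg lam. is_pos (\<sigma> u)}"

definition mcount :: "nat list \<Rightarrow> (nat \<times> nat \<Rightarrow> letter) \<Rightarrow> nat" where
  "mcount lam \<sigma> = card {u \<in> dg lam. is_neg (\<sigma> u)}"

text \<open>The content multiset {|sigma(u)| : u in dg}: it encodes the monomial x^{|sigma|}.\<close>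
definition content :: "nat list \<Rightarrow> (nat \<times> nat \<Rightarrow> letter) \<Rightarrow> nat multiset" where
  "content lam \<sigma> = image_mset (\<lambda>u. absv (\<sigma> u)) (mset_set (dg lam))"

definition has_dist_label :: "nat list \<Rightarrow> (nat \<times> nat \<Rightarrow> letter) \<Rightarrow> bool" where
  "has_dist_label lam \<sigma> \<longleftrightarrow>
     (\<exists>a > 0. \<exists>(r, j) \<in> dg lam. absv (\<sigma> (r, j)) = a \<and> r > a)"

definition dist_label :: "nat list \<Rightarrow> (nat \<times> nat \<Rightarrow> letter) \<Rightarrow> nat" where
  "dist_label lam \<sigma> =
     (LEAST a. a > 0 \<and> (\<exists>(r, j) \<in> dg lam. absv (\<sigma> (r, j)) = a \<and> r > a))"

definition reads_before :: "nat \<times> nat \<Rightarrow> nat \<times> nat \<Rightarrow> bool" where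
  "reads_before u v \<longleftrightarrow> fst u > fst v \<or> (fst u = fst v \<and> snd u > snd v)"

definition dist_cell :: "nat list \<Rightarrow> (nat \<times> nat \<Rightarrow> letter) \<Rightarrow> nat \<times> nat \<Rightarrow> bool" where
  "dist_cell lam \<sigma> u \<longleftrightarrow> u \<in> dg lam \<and> absv (\<sigma> u) = dist_label lam \<sigma> \<and>
     (\<forall>v \<in> dg lam. absv (\<sigma> v) = dist_label lam \<sigma> \<longrightarrow> v \<noteq> u \<longrightarrow> reads_before u v)"

definition in_degenerate_triple :: "nat list \<Rightarrow> nat \<times> nat \<Rightarrow> bool" where
  "in_degenerate_triple lam u \<longleftrightarrow>
     (\<exists>r i j. i < j \<and> (r, i) \<in> dg lam \<and> (r, j) \<in> dg lam \<and> ht lam i = r \<and>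
              (u = (r, i) \<or> u = (r, j)))"

definition phi_degenerate :: "nat list \<Rightarrow> (nat \<times> nat \<Rightarrow> letter) \<Rightarrow> bool" where
  "phi_degenerate lam \<sigma> \<longleftrightarrow> has_dist_label lam \<sigma> \<and>
     (\<exists>u. dist_cell lam \<sigma> u \<and> in_degenerate_triple lam u)"

end

theory Submission
  imports Defs "HOL-Combinatorics.Transposition"
begin

text \<open>
  Fix the distinguished label \<open>a\<close> and the row \<open>r\<close> of the distinguished cell. All entries in the rows
  \<open>\<ge> a\<close> have absolute value at least \<open>a\<close>, so there \<open>Pos a\<close> is the smallest and \<open>Neg a\<close> the largest
  letter. Degenerate triples in row \<open>r\<close> join columns of height exactly \<open>r\<close>; these columns form an
  interval, the block, and \<open>\<Phi>\<close>-degeneracy means that row \<open>r\<close> is the highest one containing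
  \<open>\<plusminus>a\<close>, that some block cell of row \<open>r\<close> contains it, and that the block has at least two columns.

  Let \<open>w\<close> be row \<open>r\<close> of the block, read from right to left. The degenerate triples of the block
  contribute \<open>coinv w\<close> to \<open>quinv\<close>. With this contribution removed, the sum over all fillings with
  given \<open>w\<close> depends only on the multiset of letters of \<open>w\<close> (two adjacent columns can be exchanged
  from the top downwards, as far as necessary), and it changes sign when one \<open>Pos a\<close> in \<open>w\<close>
  becomes \<open>Neg a\<close>. What remains is the vanishing of an alternating sum of \<open>t\<close>-multinomial
  coefficients.
\<close>

section \<open>The quinv condition as a function of three letters\<close>

definition qtriple :: "letter \<Rightarrow> letter \<Rightarrow> letter \<Rightarrow> bool" where
  "qtriple a b c \<longleftrightarrow> length (filter id [Ind a b, \<not> Ind c b, \<not> Ind a c]) = 1"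

text \<open>By linearity, if replacing \<open>a\<close> by \<open>d\<close> does not change the status of the triple \<open>(a, b, c)\<close>,
  then exchanging \<open>a\<close> and \<open>d\<close> above \<open>b\<close> and \<open>c\<close> preserves both the number of descents and the number
  of quinv triples formed with a third column.\<close>
lemma qtriple_linear:
  "(of_bool (qtriple a b c) :: int) = of_bool (Ind c b) + of_bool (Ind a c) - of_bool (Ind a b)"
  unfolding qtriple_def Ind_def by (cases a; cases b; cases c) auto

text \<open>\<open>Ind Zero b\<close> never holds, so one term of the linear formula survives. A
  degenerate triple is thus a coinversion of its row read from right to left.\<close>

lemma qtriple_Zero: "qtriple Zero b c \<longleftrightarrow> Ind c b"
  unfolding qtriple_def Ind_def by (cases b; cases c) auto

lemma Ind_swap: "b \<noteq> c \<Longrightarrow> Ind b c \<longleftrightarrow> \<not> Ind c b"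
  unfolding Ind_def by (cases b; cases c) auto

text \<open>In the sum of the two linear formulas the terms with \<open>a\<close> cancel, while
  \<open>Ind c b\<close> and \<open>Ind b c\<close> add up to 1.\<close>

lemma qtriple_swap: "b \<noteq> c \<Longrightarrow> qtriple a c b \<longleftrightarrow> \<not> qtriple a b c"
  using qtriple_linear[of a b c] qtriple_linear[of a c b] Ind_swap[of b c]
  by (auto simp: of_bool_def split: if_splits)

subsection \<open>Words\<close>

fun coinv :: "letter list \<Rightarrow> nat" where
  "coinv [] = 0"
| "coinv (x # w) = length (filter (Ind x) w) + coinv w"

lemma coinv_swap:
  "coinv (u @ y # x # v) + of_bool (Ind x y) = coinv (u @ x # y # v) + of_bool (Ind y x)"
  by (induction u) auto

text \<open>The first letter of \<open>w\<close> is moved to the front of \<open>w'\<close> by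
  adjacent swaps; the tails are then compared under \<open>f\<close> with this letter
  prefixed.\<close>

lemma adjacent_swap_invariant_imp_mset_invariant:
  assumes "\<And>u x y v. f (u @ x # y # v) = f (u @ y # x # v)" and "mset w = mset w'"
  shows "f w = f w'"
  using assms
proof (induction w arbitrary: w' f)
  case Nil
  then show ?case by simp
next
  case (Cons x w)
  have "x \<in> set w'" using Cons.prems(2) by (metis list.set_intros(1) set_mset_mset)
  then obtain u v where w': "w' = u @ x # v" by (meson split_list)
  note swap = Cons.prems(1)
  \<comment> \<open>\<open>z\<close> collects the letters of \<open>u\<close> that become part of
    the fixed prefix.\<close>
  have front: "f (z @ u @ x # v) = f (z @ x # u @ v)" for z
  proof (induction u arbitrary: z)
    case (Cons y u)
    show ?case using Cons.IH[of "z @ [y]"] swap[of z y x "u @ v"] by simp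
  qed simp
  have "f (x # w) = f (x # u @ v)"
  proof (rule Cons.IH[where f = "\<lambda>w. f (x # w)"])
    show "f (x # (u' @ y # z # v')) = f (x # (u' @ z # y # v'))" for u' y z v'
      using Cons.prems(1)[of "x # u'"] by simp
    show "mset w = mset (u @ v)" using Cons.prems(2) w' by simp
  qed
  then show ?case using front[of "[]"] w' by simp
qed

text \<open>\<open>pmx_sum t p m N\<close> sums \<open>t ^ coinv\<close> over the words with \<open>p\<close> letters \<open>P\<close>, \<open>m\<close> letters \<open>M\<close> and
  \<open>N\<close> unspecified letters \<open>X\<close>, where \<open>P\<close> is minimal, \<open>M\<close> maximal, and two \<open>X\<close> do not interact.\<close>
fun pmx_sum :: "'r::comm_ring_1 \<Rightarrow> nat \<Rightarrow> nat \<Rightarrow> nat \<Rightarrow> 'r" where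
  "pmx_sum t p m N = (if p = 0 \<and> m = 0 \<and> N = 0 then 1 else
      (if p = 0 then 0 else pmx_sum t (p - 1) m N)
    + (if N = 0 then 0 else t ^ p * pmx_sum t p m (N - 1))
    + (if m = 0 then 0 else t ^ (p + m + N - 1) * pmx_sum t p (m - 1) N))"
declare pmx_sum.simps [simp del]

text \<open>\<open>pmx_sum t p m N\<close> is \<open>t ^ (m choose 2)\<close> times the
  \<open>t\<close>-multinomial coefficient of \<open>(p, m, N)\<close>; trading an \<open>X\<close>
  for an \<open>M\<close> changes it by a quotient of \<open>t\<close>-integers. Denominators are
  cleared because \<open>t\<close> lies in an arbitrary commutative ring.\<close>

lemma pmx_sum_absorption:
  "(1 - t ^ Suc m) * pmx_sum t p (Suc m) N = t ^ m * (1 - t ^ Suc N) * pmx_sum t p m (Suc N)"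
proof (induction "p + m + N" arbitrary: p m N rule: less_induct)
  case less
  define P where "P = (if p = 0 then 0 else pmx_sum t (p - 1) (Suc m) N)"
  define P' where "P' = (if p = 0 then 0 else pmx_sum t (p - 1) m (Suc N))"
  define X where "X = (if N = 0 then 0 else pmx_sum t p (Suc m) (N - 1))"
  define Y where "Y = (if m = 0 then 0 else pmx_sum t p (m - 1) (Suc N))"
  define g where "g = pmx_sum t p m N"
  have L: "pmx_sum t p (Suc m) N = P + t ^ p * X + t ^ (p + m + N) * g"
    by (subst pmx_sum.simps) (simp add: P_def X_def g_def)
  have R: "pmx_sum t p m (Suc N) = P' + t ^ p * g + t ^ (p + m + N) * Y"
    by (subst pmx_sum.simps) (simp add: P'_def Y_def g_def)
  have 1: "(1 - t ^ Suc m) * P = t ^ m * (1 - t ^ Suc N) * P'"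
    using less[of "p - 1" m N] by (auto simp: P_def P'_def)
  \<comment> \<open>For \<open>N = 0\<close> both sides vanish, since \<open>1 - t ^ 0 = 0\<close>;
    the same happens in \<open>3\<close> for \<open>m = 0\<close>.\<close>
  have 2: "(1 - t ^ Suc m) * X = t ^ m * (1 - t ^ N) * g"
    using less[of p m "N - 1"] by (cases N) (auto simp: X_def g_def)
  have 3: "t ^ m * (1 - t ^ Suc N) * Y = t * (1 - t ^ m) * g"
    using less[of p "m - 1" N] by (cases m) (auto simp: Y_def g_def mult.assoc)
  have "(1 - t ^ Suc m) * pmx_sum t p (Suc m) N =
      (1 - t ^ Suc m) * P + t ^ p * ((1 - t ^ Suc m) * X) + (1 - t ^ Suc m) * t ^ (p + m + N) * g"
    unfolding L by (simp add: algebra_simps)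
  also have "\<dots> = t ^ m * (1 - t ^ Suc N) * P' + t ^ m * (1 - t ^ Suc N) * t ^ p * g
      + t ^ (p + m + N) * (t * (1 - t ^ m) * g)"
    unfolding 1 2 by (simp add: algebra_simps power_add)
  also have "\<dots> = t ^ m * (1 - t ^ Suc N) * pmx_sum t p m (Suc N)"
    unfolding R 3[symmetric] by (simp add: algebra_simps)
  finally show ?case .
qed

text \<open>The recursion that results from letting \<open>M\<close> be the second smallest letter instead of the
  largest one.\<close>
lemma pmx_sum_rec:
  assumes "p + m > 0"
  shows "pmx_sum t p m N = (if p = 0 then 0 else pmx_sum t (p - 1) m N)
    + (if N = 0 then 0 else t ^ (p + m) * pmx_sum t p m (N - 1))
    + (if m = 0 then 0 else t ^ (p + m - 1) * pmx_sum t p (m - 1) N)"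
proof (cases "m = 0 \<or> N = 0")
  case True
  then show ?thesis using assms by (subst pmx_sum.simps) auto
next
  case False
  then obtain m' N' where [simp]: "m = Suc m'" "N = Suc N'"
    by (metis not0_implies_Suc)
  \<comment> \<open>The difference of the two recursions is \<open>t ^ p\<close> times an instance
    of absorption.\<close>
  have "t ^ p * ((1 - t ^ Suc m') * pmx_sum t p (Suc m') N') =
        t ^ p * (t ^ m' * (1 - t ^ Suc N') * pmx_sum t p m' (Suc N'))"
    by (simp only: pmx_sum_absorption)
  then show ?thesis
    by (subst pmx_sum.simps) (simp add: algebra_simps power_add)
qed

text \<open>In \<open>pmx_sum_rec\<close> the exponents depend only on \<open>p + m = k\<close>, so
  the alternating sum itself satisfies a recursion. After a shift of \<open>m\<close> its
  \<open>P\<close> and \<open>M\<close> terms combine to \<open>1 - t ^ (k - 1)\<close> times the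
  sum for \<open>k - 1\<close>.\<close>

lemma pmx_sum_alternating:
  assumes "k > 0"
  shows "(\<Sum>m\<le>k. (- 1) ^ m * pmx_sum t (k - m) m N) = 0"
  using assms
proof (induction "k + N" arbitrary: k N rule: less_induct)
  case less
  define f where "f k N = (\<Sum>m\<le>k. (- 1) ^ m * pmx_sum t (k - m) m N)" for k N
  obtain k' where k: "k = Suc k'" using less.prems by (cases k) auto
  have "f k N = (\<Sum>m\<le>k. (- 1) ^ m * ((if k - m = 0 then 0 else pmx_sum t (k - m - 1) m N)
      + (if N = 0 then 0 else t ^ k * pmx_sum t (k - m) m (N - 1))
      + (if m = 0 then 0 else t ^ k' * pmx_sum t (k - m) (m - 1) N)))"
    unfolding f_def
  proof (intro sum.cong refl arg_cong2[where f = "(*)"])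
    fix m assume "m \<in> {..k}"
    then show "pmx_sum t (k - m) m N = (if k - m = 0 then 0 else pmx_sum t (k - m - 1) m N)
      + (if N = 0 then 0 else t ^ k * pmx_sum t (k - m) m (N - 1))
      + (if m = 0 then 0 else t ^ k' * pmx_sum t (k - m) (m - 1) N)"
      using pmx_sum_rec[of "k - m" m t N] k by simp
  qed
  also have "\<dots> = (\<Sum>m\<le>k. (- 1) ^ m * (if k - m = 0 then 0 else pmx_sum t (k - m - 1) m N))
      + (\<Sum>m\<le>k. (- 1) ^ m * (if N = 0 then 0 else t ^ k * pmx_sum t (k - m) m (N - 1)))
      + (\<Sum>m\<le>k. (- 1) ^ m * (if m = 0 then 0 else t ^ k' * pmx_sum t (k - m) (m - 1) N))"
    by (simp add: sum.distrib distrib_left)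
  also have "(\<Sum>m\<le>k. (- 1) ^ m * (if k - m = 0 then 0 else pmx_sum t (k - m - 1) m N)) = f k' N"
    unfolding k f_def sum.atMost_Suc by (auto intro!: sum.cong)
  also have "(\<Sum>m\<le>k. (- 1) ^ m * (if N = 0 then 0 else t ^ k * pmx_sum t (k - m) m (N - 1))) =
      (if N = 0 then 0 else t ^ k * f k (N - 1))"
    unfolding f_def by (simp add: sum_distrib_left mult_ac)
  also have "(\<Sum>m\<le>k. (- 1) ^ m * (if m = 0 then 0 else t ^ k' * pmx_sum t (k - m) (m - 1) N)) =
      - (t ^ k' * f k' N)"
    unfolding k f_def sum.atMost_Suc_shift by (simp add: sum_distrib_left mult_ac sum_negf)
  finally have "f k N = (1 - t ^ k') * f k' N + (if N = 0 then 0 else t ^ k * f k (N - 1))"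
    by (simp add: algebra_simps)
  \<comment> \<open>The induction hypothesis does not cover \<open>k' = 0\<close>, but there the
    factor is 0.\<close>
  moreover have "(1 - t ^ k') * f k' N = 0"
    using less.hyps[of k' N] k by (cases "k' = 0") (auto simp: f_def)
  moreover have "f k (N - 1) = 0" if "N \<noteq> 0"
    using less.hyps[of k "N - 1"] less.prems that by (auto simp: f_def)
  ultimately show ?case by (auto simp: f_def)
qed

section \<open>Weighted sums over words\<close>

definition words :: "letter set \<Rightarrow> nat \<Rightarrow> letter list set" where
  "words A n = {w. set w \<subseteq> A \<and> length w = n}"

lemma words_0 [simp]: "words A 0 = {[]}"
  by (auto simp: words_def)

lemma finite_words: "finite A \<Longrightarrow> finite (words A n)"
  unfolding words_def by (rule finite_lists_length_eq)

lemma sum_words_Suc: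
  assumes "finite A"
  shows "(\<Sum>w\<in>words A (Suc n). f w) = (\<Sum>x\<in>A. \<Sum>w\<in>words A n. f (x # w))"
proof -
  have "words A (Suc n) = (\<lambda>(x, w). x # w) ` (A \<times> words A n)"
    by (auto simp: words_def length_Suc_conv image_iff)
  then show ?thesis
    by (simp add: sum.reindex inj_on_def sum.cartesian_product case_prod_unfold o_def)
qed

text \<open>Words are peeled from the left. The weight \<open>s\<close> is arbitrary so that it can
  absorb the removed letter and its coinversions, which depend only on the multiset of the remaining
  letters.\<close>

lemma sum_words_supported:
  fixes t :: "'r::comm_ring_1" and s :: "letter multiset \<Rightarrow> 'r"
  assumes "finite X" "P \<notin> X" "M \<notin> X" "P \<noteq> M"
    and P: "\<And>x. x \<in> insert P (insert M X) \<Longrightarrow> \<not> Ind P x" "\<And>x. x \<in> X \<Longrightarrow> Ind x P"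
    and M: "\<And>x. x \<in> insert P (insert M X) \<Longrightarrow> Ind M x" "\<And>x. x \<in> X \<Longrightarrow> \<not> Ind x M"
    and supp: "\<And>K. s K \<noteq> 0 \<Longrightarrow> count K P = p \<and> count K M = m"
  shows "(\<Sum>w\<in>words (insert P (insert M X)) (p + m + N). t ^ coinv w * s (mset w)) =
     pmx_sum t p m N *
     (\<Sum>v\<in>words X N. t ^ coinv v * s (mset v + replicate_mset p P + replicate_mset m M))"
  using supp
proof (induction "p + m + N" arbitrary: p m N s)
  case 0
  then show ?case by (simp add: pmx_sum.simps)
next
  case (Suc n)
  let ?A = "insert P (insert M X)"
  let ?U = "\<Sum>v\<in>words X N. t ^ coinv v * s (mset v + replicate_mset p P + replicate_mset m M)"
  have supp: "s K = 0" if "count K P \<noteq> p \<or> count K M \<noteq> m" for K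
    using Suc.prems that by blast
  have "(\<Sum>w\<in>words ?A (p + m + N). t ^ coinv w * s (mset w)) =
     (\<Sum>w\<in>words ?A n. t ^ coinv (P # w) * s (add_mset P (mset w))) +
     ((\<Sum>w\<in>words ?A n. t ^ coinv (M # w) * s (add_mset M (mset w))) +
     (\<Sum>x\<in>X. \<Sum>w\<in>words ?A n. t ^ coinv (x # w) * s (add_mset x (mset w))))"
    unfolding Suc.hyps(2)[symmetric]
    by (subst sum_words_Suc) (use assms(1-4) in auto)
  also have "(\<Sum>w\<in>words ?A n. t ^ coinv (P # w) * s (add_mset P (mset w))) =
     (if p = 0 then 0 else pmx_sum t (p - 1) m N * ?U)"
  proof -
    have "(\<Sum>w\<in>words ?A n. t ^ coinv (P # w) * s (add_mset P (mset w))) =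
        (\<Sum>w\<in>words ?A n. t ^ coinv w * s (add_mset P (mset w)))"
    proof (intro sum.cong refl)
      fix w assume "w \<in> words ?A n"
      then have "filter (Ind P) w = []"
        using P(1) by (auto simp: words_def filter_empty_conv)
      then show "t ^ coinv (P # w) * s (add_mset P (mset w)) = t ^ coinv w * s (add_mset P (mset w))"
        by simp
    qed
    also have "\<dots> = (if p = 0 then 0 else pmx_sum t (p - 1) m N * ?U)"
    proof (cases p)
      case 0
      then show ?thesis using supp by auto
    next
      case (Suc p')
      have n: "n = p' + m + N" using Suc.hyps(2) Suc by simp
      show ?thesis
        using Suc.hyps(1)[OF n, of "\<lambda>K. s (add_mset P K)"] Suc.prems \<open>P \<noteq> M\<close> Suc n
        by (force simp: ac_simps)
    qed
    finally show ?thesis .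
  qed
  also have "(\<Sum>w\<in>words ?A n. t ^ coinv (M # w) * s (add_mset M (mset w))) =
     (if m = 0 then 0 else t ^ (p + m + N - 1) * pmx_sum t p (m - 1) N * ?U)"
  proof -
    have "(\<Sum>w\<in>words ?A n. t ^ coinv (M # w) * s (add_mset M (mset w))) =
        t ^ n * (\<Sum>w\<in>words ?A n. t ^ coinv w * s (add_mset M (mset w)))"
      unfolding sum_distrib_left
    proof (intro sum.cong refl)
      fix w assume w: "w \<in> words ?A n"
      then have "filter (Ind M) w = w"
        using M(1) by (auto simp: words_def filter_id_conv)
      then show "t ^ coinv (M # w) * s (add_mset M (mset w)) =
          t ^ n * (t ^ coinv w * s (add_mset M (mset w)))"
        using w by (simp add: words_def power_add)
    qed
    also have "\<dots> = (if m = 0 then 0 else t ^ (p + m + N - 1) * pmx_sum t p (m - 1) N * ?U)"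
    proof (cases m)
      case 0
      then show ?thesis using supp by auto
    next
      case (Suc m')
      have n: "n = p + m' + N" using Suc.hyps(2) Suc by simp
      show ?thesis
        using Suc.hyps(1)[OF n, of "\<lambda>K. s (add_mset M K)"] Suc.prems \<open>P \<noteq> M\<close> Suc n
        by (force simp: ac_simps)
    qed
    finally show ?thesis .
  qed
  also have "(\<Sum>x\<in>X. \<Sum>w\<in>words ?A n. t ^ coinv (x # w) * s (add_mset x (mset w))) =
     (if N = 0 then 0 else t ^ p * pmx_sum t p m (N - 1) * ?U)"
  proof (cases N)
    case 0
    \<comment> \<open>After a letter of \<open>X\<close>, only \<open>p + m - 1\<close> places
      remain for \<open>p\<close> letters \<open>P\<close> and \<open>m\<close> letters
      \<open>M\<close>.\<close>
    have "s (add_mset x (mset w)) = 0" if "x \<in> X" "w \<in> words ?A n" for x w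
    proof (rule ccontr)
      assume "s (add_mset x (mset w)) \<noteq> 0"
      then have c: "count (mset w) P = p" "count (mset w) M = m"
        using Suc.prems[of "add_mset x (mset w)"] assms(2,3) that(1) by (auto split: if_splits)
      have "replicate_mset p P + replicate_mset m M \<subseteq># mset w"
        using c \<open>P \<noteq> M\<close> by (intro mset_subset_eqI) auto
      then have "p + m \<le> size (mset w)" by (metis size_mset_mono size_replicate_mset size_union)
      then show False using that(2) Suc.hyps(2) 0 by (simp add: words_def)
    qed
    then show ?thesis using 0 by simp
  next
    case (Suc N')
    have n: "n = p + m + N'" using Suc.hyps(2) Suc by simp
    have "(\<Sum>w\<in>words ?A n. t ^ coinv (x # w) * s (add_mset x (mset w))) =
        pmx_sum t p m N' * t ^ p * (\<Sum>v\<in>words X N'. t ^ coinv (x # v) *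
          s (add_mset x (mset v) + replicate_mset p P + replicate_mset m M))" if x: "x \<in> X" for x
    proof -
      let ?s = "\<lambda>K. t ^ size (filter_mset (Ind x) K) * s (add_mset x K)"
      have "(\<Sum>w\<in>words ?A n. t ^ coinv (x # w) * s (add_mset x (mset w))) =
          (\<Sum>w\<in>words ?A n. t ^ coinv w * ?s (mset w))"
        by (intro sum.cong refl) (simp add: power_add mult_ac flip: mset_filter)
      also have "\<dots> = pmx_sum t p m N' *
          (\<Sum>v\<in>words X N'. t ^ coinv v * ?s (mset v + replicate_mset p P + replicate_mset m M))"
        unfolding n
      proof (rule Suc.hyps(1)[OF n])
        fix K assume "?s K \<noteq> 0"
        then have "s (add_mset x K) \<noteq> 0" by auto
        then show "count K P = p \<and> count K M = m"
          using Suc.prems x assms(2,3) by fastforce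
      qed
      also have "(\<Sum>v\<in>words X N'. t ^ coinv v * ?s (mset v + replicate_mset p P + replicate_mset m M)) =
          t ^ p * (\<Sum>v\<in>words X N'. t ^ coinv (x # v) *
          s (add_mset x (mset v) + replicate_mset p P + replicate_mset m M))"
      proof -
        \<comment> \<open>\<open>x\<close> forms coinversions with every \<open>P\<close> and with
          no \<open>M\<close>; hence the factor \<open>t ^ p\<close>.\<close>
        have f1: "filter_mset (Ind x) (replicate_mset p P) = replicate_mset p P"
          using P(2)[OF x] by (auto simp: filter_mset_eq_conv)
        have f2: "filter_mset (Ind x) (replicate_mset m M) = {#}"
          using M(2)[OF x] by (auto simp: filter_mset_eq_conv)
        show ?thesis
          by (simp add: f1 f2 sum_distrib_left power_add mult_ac flip: mset_filter)
      qed
      finally show ?thesis by (simp add: mult_ac)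
    qed
    then have "(\<Sum>x\<in>X. \<Sum>w\<in>words ?A n. t ^ coinv (x # w) * s (add_mset x (mset w))) =
        pmx_sum t p m N' * t ^ p * (\<Sum>x\<in>X. \<Sum>v\<in>words X N'. t ^ coinv (x # v) *
          s (add_mset x (mset v) + replicate_mset p P + replicate_mset m M))"
      by (simp add: sum_distrib_left)
    also have "(\<Sum>x\<in>X. \<Sum>v\<in>words X N'. t ^ coinv (x # v) *
          s (add_mset x (mset v) + replicate_mset p P + replicate_mset m M)) = ?U"
      unfolding Suc by (subst sum_words_Suc[OF assms(1)]) simp
    finally show ?thesis using Suc by (simp add: mult_ac)
  qed
  finally show ?case
    using Suc.hyps(2) by (subst pmx_sum.simps) (auto simp: algebra_simps)
qed

text \<open>\<open>s\<close> is split by the number \<open>m\<close> of letters \<open>M\<close> and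
  the number \<open>k\<close> of letters \<open>P\<close> or \<open>M\<close>. Antisymmetry turns
  each \<open>M\<close> into a \<open>P\<close> up to sign, so for fixed \<open>k\<close> the sum
  over the words \<open>v\<close> on \<open>X\<close> is the same for all \<open>m\<close>, and
  \<open>pmx_sum_alternating\<close> applies. The case \<open>k = 0\<close> is excluded by
  \<open>supp\<close>.\<close>

lemma sum_words_antisymmetric_eq_0:
  fixes t :: "'r::comm_ring_1" and s :: "letter multiset \<Rightarrow> 'r"
  assumes X: "finite X" "P \<notin> X" "M \<notin> X" "P \<noteq> M"
    and P: "\<And>x. x \<in> insert P (insert M X) \<Longrightarrow> \<not> Ind P x" "\<And>x. x \<in> X \<Longrightarrow> Ind x P"
    and M: "\<And>x. x \<in> insert P (insert M X) \<Longrightarrow> Ind M x" "\<And>x. x \<in> X \<Longrightarrow> \<not> Ind x M"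
    and anti: "\<And>K. s (add_mset M K) = - s (add_mset P K)"
    and supp: "\<And>K. P \<notin># K \<Longrightarrow> M \<notin># K \<Longrightarrow> s K = 0"
  shows "(\<Sum>w\<in>words (insert P (insert M X)) n. t ^ coinv w * s (mset w)) = 0"
proof -
  let ?A = "insert P (insert M X)"
  define s' where "s' k m K = (if count K P = k - m \<and> count K M = m then s K else 0)" for k m K
  have split: "s (mset w) = (\<Sum>k\<in>{1..n}. \<Sum>m\<le>k. s' k m (mset w))" if "w \<in> words ?A n" for w
  proof -
    let ?p = "count (mset w) P" and ?m = "count (mset w) M"
    have "replicate_mset ?p P + replicate_mset ?m M \<subseteq># mset w"
      using X by (intro mset_subset_eqI) auto
    then have "?p + ?m \<le> size (mset w)" by (metis size_mset_mono size_replicate_mset size_union)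
    then have le: "?p + ?m \<le> n" using that by (simp add: words_def)
    have "(\<Sum>m\<le>k. s' k m (mset w)) = (if k = ?p + ?m then s (mset w) else 0)" for k
    proof (cases "k = ?p + ?m")
      case True
      then have "(\<Sum>m\<le>k. s' k m (mset w)) = (\<Sum>m\<in>{?m}. s' k m (mset w))"
        by (intro sum.mono_neutral_right) (auto simp: s'_def)
      then show ?thesis using True by (simp add: s'_def)
    next
      case False
      then show ?thesis by (auto intro!: sum.neutral simp: s'_def)
    qed
    then have "(\<Sum>k\<in>{1..n}. \<Sum>m\<le>k. s' k m (mset w)) =
        (if ?p + ?m \<in> {1..n} then s (mset w) else 0)"
      by (simp add: sum.delta')
    moreover have "s (mset w) = 0" if "?p + ?m = 0"
      using that supp[of "mset w"] by (simp add: count_eq_zero_iff)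
    ultimately show ?thesis using le by (auto simp: Suc_le_eq)
  qed
  have anti': "s (K + replicate_mset p P + replicate_mset m M) =
      (- 1) ^ m * s (K + replicate_mset (p + m) P)" for K p m
  proof (induction m arbitrary: p)
    case (Suc m)
    show ?case using anti Suc.IH[of "Suc p"] by simp
  qed simp
  have part: "(\<Sum>w\<in>words ?A n. t ^ coinv w * s' k m (mset w)) =
      (- 1) ^ m * pmx_sum t (k - m) m (n - k) *
      (\<Sum>v\<in>words X (n - k). t ^ coinv v * s (mset v + replicate_mset k P))"
    if "k \<le> n" "m \<le> k" for k m
  proof -
    have "(\<Sum>w\<in>words ?A ((k - m) + m + (n - k)). t ^ coinv w * s' k m (mset w)) =
      pmx_sum t (k - m) m (n - k) * (\<Sum>v\<in>words X (n - k). t ^ coinv v *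
        s' k m (mset v + replicate_mset (k - m) P + replicate_mset m M))"
      by (rule sum_words_supported[OF X P M]) (auto simp: s'_def split: if_splits)
    also have "(\<Sum>v\<in>words X (n - k). t ^ coinv v *
        s' k m (mset v + replicate_mset (k - m) P + replicate_mset m M)) =
       (\<Sum>v\<in>words X (n - k). (- 1) ^ m * (t ^ coinv v * s (mset v + replicate_mset k P)))"
    proof (intro sum.cong refl)
      fix v assume "v \<in> words X (n - k)"
      then have "P \<notin> set v" "M \<notin> set v" using X by (auto simp: words_def)
      then have "count (mset v) P = 0" "count (mset v) M = 0" by (auto simp: count_eq_zero_iff)
      then have "s' k m (mset v + replicate_mset (k - m) P + replicate_mset m M) =
          s (mset v + replicate_mset (k - m) P + replicate_mset m M)"
        using X by (simp add: s'_def)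
      then show "t ^ coinv v * s' k m (mset v + replicate_mset (k - m) P + replicate_mset m M) =
          (- 1) ^ m * (t ^ coinv v * s (mset v + replicate_mset k P))"
        using anti'[of "mset v" "k - m" m] that by (simp add: mult_ac)
    qed
    finally show ?thesis using that by (simp only: sum_distrib_left[symmetric]) (simp add: mult_ac)
  qed
  have "(\<Sum>w\<in>words ?A n. t ^ coinv w * s (mset w)) =
      (\<Sum>w\<in>words ?A n. \<Sum>k\<in>{1..n}. \<Sum>m\<le>k. t ^ coinv w * s' k m (mset w))"
    by (intro sum.cong refl) (simp add: split sum_distrib_left)
  also have "\<dots> = (\<Sum>k\<in>{1..n}. \<Sum>w\<in>words ?A n. \<Sum>m\<le>k. t ^ coinv w * s' k m (mset w))"
    by (rule sum.swap)
  also have "\<dots> = (\<Sum>k\<in>{1..n}. \<Sum>m\<le>k. \<Sum>w\<in>words ?A n. t ^ coinv w * s' k m (mset w))"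
    by (intro sum.cong refl sum.swap)
  also have "\<dots> = (\<Sum>k\<in>{1..n}. (\<Sum>m\<le>k. (- 1) ^ m * pmx_sum t (k - m) m (n - k)) *
      (\<Sum>v\<in>words X (n - k). t ^ coinv v * s (mset v + replicate_mset k P)))"
    by (intro sum.cong refl) (auto simp: part sum_distrib_right)
  also have "\<dots> = 0"
    by (intro sum.neutral ballI) (auto simp: pmx_sum_alternating)
  finally show ?thesis .
qed

subsection \<open>Row decomposition of the statistics\<close>

definition row :: "nat list \<Rightarrow> nat \<Rightarrow> nat set" where
  "row lam k = {j. (k, j) \<in> dg lam}"

lemma finite_dg: "finite (dg lam)"
proof -
  have "dg lam \<subseteq> (\<lambda>(i, r). (r, i)) ` (SIGMA i:{1..length lam}. {1..ht lam i})"
    by (auto simp: dg_def image_iff)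
  then show ?thesis by (rule finite_subset) auto
qed

lemma finite_row: "finite (row lam k)"
proof -
  have "row lam k \<subseteq> {1..length lam}" by (auto simp: row_def dg_def)
  then show ?thesis by (rule finite_subset) auto
qed

lemma dg_eq_Sigma_row: "dg lam = (SIGMA k:fst ` dg lam. row lam k)"
  by (force simp: row_def)

text \<open>The row \<open>v\<close> and the row \<open>u\<close> above it are separate arguments,
  so that columns can be exchanged in one of them alone. Values in \<open>int\<close> suit the
  subtraction in the linear formula.\<close>

definition quinv_row :: "nat list \<Rightarrow> nat \<Rightarrow> (nat \<Rightarrow> letter) \<Rightarrow> (nat \<Rightarrow> letter) \<Rightarrow> int" where
  "quinv_row lam k u v =
     (\<Sum>(x, y)\<in>(SIGMA x:row lam k. {y \<in> row lam k. x < y}). of_bool (qtriple (u x) (v x) (v y)))"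

text \<open>Here \<open>v\<close> is the row below \<open>u\<close>. The condition
  \<open>1 < k\<close> matters: a filling is \<open>Zero\<close> below the bottom row, and
  \<open>Ind x Zero\<close> holds for every genuine letter \<open>x\<close>.\<close>

definition maj_row :: "nat list \<Rightarrow> nat \<Rightarrow> (nat \<Rightarrow> letter) \<Rightarrow> (nat \<Rightarrow> letter) \<Rightarrow> int" where
  "maj_row lam k u v =
     (\<Sum>x\<in>row lam k. int (ht lam x - k + 1) * of_bool (1 < k \<and> Ind (u x) (v x)))"

lemma finite_triples: "finite (triples lam)"
proof -
  have "triples lam \<subseteq> (\<lambda>((r, i), (_, j)). (r, i, j)) ` (dg lam \<times> dg lam)"
    by (force simp: triples_def image_iff)
  then show ?thesis by (rule finite_subset) (simp add: finite_dg)
qed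

lemma quinv_triple_eq:
  assumes "super_filling lam \<sigma>"
  shows "quinv_triple lam \<sigma> (k, x, y) \<longleftrightarrow> qtriple (\<sigma> (Suc k, x)) (\<sigma> (k, x)) (\<sigma> (k, y))"
  using assms by (auto simp: quinv_triple_def qtriple_def super_filling_def Let_def)

lemma quinv_eq_sum_rows:
  assumes "super_filling lam \<sigma>"
  shows "int (quinv lam \<sigma>) =
    (\<Sum>k\<in>fst ` dg lam. quinv_row lam k (\<lambda>x. \<sigma> (Suc k, x)) (\<lambda>x. \<sigma> (k, x)))"
proof -
  have T: "triples lam = (SIGMA k:fst ` dg lam. SIGMA x:row lam k. {y \<in> row lam k. x < y})"
    by (force simp: triples_def row_def)
  have "int (quinv lam \<sigma>) = (\<Sum>x\<in>triples lam. of_bool (quinv_triple lam \<sigma> x))"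
    by (simp add: quinv_def finite_triples sum.If_cases of_bool_def Int_def)
  also have "\<dots> = (\<Sum>(k, x, y)\<in>triples lam. of_bool (qtriple (\<sigma> (Suc k, x)) (\<sigma> (k, x)) (\<sigma> (k, y))))"
    by (intro sum.cong refl) (auto simp: quinv_triple_eq[OF assms])
  also have "\<dots> = (\<Sum>k\<in>fst ` dg lam. quinv_row lam k (\<lambda>x. \<sigma> (Suc k, x)) (\<lambda>x. \<sigma> (k, x)))"
    unfolding T quinv_row_def by (subst sum.Sigma) (auto simp: finite_dg finite_row)
  finally show ?thesis .
qed

lemma maj_eq_sum_rows:
  "int (maj lam \<sigma>) =
    (\<Sum>k\<in>fst ` dg lam. maj_row lam k (\<lambda>x. \<sigma> (k, x)) (\<lambda>x. \<sigma> (k - 1, x)))"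
proof -
  have "int (maj lam \<sigma>) = (\<Sum>u\<in>dg lam. int (leg lam u + 1) * of_bool (descent lam \<sigma> u))"
    unfolding maj_def by (simp add: finite_dg of_bool_def if_distrib sum.If_cases Int_def cong: if_cong)
  also have "\<dots> = (\<Sum>(k, x)\<in>dg lam. int (ht lam x - k + 1) *
      of_bool (1 < k \<and> Ind (\<sigma> (k, x)) (\<sigma> (k - 1, x))))"
    by (intro sum.cong refl) (auto simp: leg_def descent_def)
  also have "\<dots> = (\<Sum>k\<in>fst ` dg lam. maj_row lam k (\<lambda>x. \<sigma> (k, x)) (\<lambda>x. \<sigma> (k - 1, x)))"
    unfolding maj_row_def
    by (subst dg_eq_Sigma_row, subst sum.Sigma) (auto simp: finite_dg finite_row)
  finally show ?thesis .
qed

subsection \<open>Swapping adjacent columns of equal height\<close>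

locale adjacent_columns =
  fixes lam :: "nat list" and i r :: nat
  assumes cols: "1 \<le> i" "Suc i \<le> length lam" "ht lam i = r" "ht lam (Suc i) = r" "1 \<le> r"
begin

abbreviation s :: "nat \<Rightarrow> nat" where "s \<equiv> transpose i (Suc i)"

lemma ht_s [simp]: "ht lam (s x) = ht lam x"
  using cols by (auto simp: transpose_def)

lemma mem_dg_s [simp]: "(k, s x) \<in> dg lam \<longleftrightarrow> (k, x) \<in> dg lam"
  using cols by (auto simp: dg_def transpose_def)

lemma mem_row_s [simp]: "s x \<in> row lam k \<longleftrightarrow> x \<in> row lam k"
  by (simp add: row_def)

lemma mem_row_cols: "i \<in> row lam k \<longleftrightarrow> 1 \<le> k \<and> k \<le> r" "Suc i \<in> row lam k \<longleftrightarrow> 1 \<le> k \<and> k \<le> r"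
  using cols by (auto simp: row_def dg_def)

lemma s_less: "x < y \<Longrightarrow> s x < s y \<or> x = i \<and> y = Suc i"
  by (auto simp: transpose_def)

lemma maj_row_swap_both: "maj_row lam k (u \<circ> s) (v \<circ> s) = maj_row lam k u v"
  unfolding maj_row_def
  by (rule sum.reindex_bij_witness[of _ s s]) auto

lemma sum_swap_cols:
  fixes f :: "letter \<Rightarrow> nat \<Rightarrow> int"
  assumes "i \<in> R" "Suc i \<in> R" "finite R"
    and "f (u (Suc i)) i + f (u i) (Suc i) = f (u i) i + f (u (Suc i)) (Suc i)"
  shows "(\<Sum>x\<in>R. f (u (s x)) x) = (\<Sum>x\<in>R. f (u x) x)"
proof -
  have R: "R = insert i (insert (Suc i) (R - {i, Suc i}))" using assms by auto
  have "(\<Sum>x\<in>R - {i, Suc i}. f (u (s x)) x) = (\<Sum>x\<in>R - {i, Suc i}. f (u x) x)"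
    by (intro sum.cong refl) (auto simp: transpose_def)
  then show ?thesis
    using assms(3,4) by (subst (1 2) R) (simp add: transpose_def)
qed

text \<open>By linearity, the hypothesis says that the two columns have as many descents in this row
  after the exchange as before. Both columns have height \<open>r\<close>, so these descents carry
  equal weights.\<close>

lemma maj_row_swap_top:
  assumes "qtriple (u i) (v i) (v (Suc i)) \<longleftrightarrow> qtriple (u (Suc i)) (v i) (v (Suc i))"
    and "1 \<le> k" "k \<le> r"
  shows "maj_row lam k (u \<circ> s) v = maj_row lam k u v"
proof -
  have q: "(of_bool (Ind (u (Suc i)) (v i)) :: int) + of_bool (Ind (u i) (v (Suc i))) =
      of_bool (Ind (u i) (v i)) + of_bool (Ind (u (Suc i)) (v (Suc i)))"
    using arg_cong[OF assms(1), of "of_bool :: _ \<Rightarrow> int"] unfolding qtriple_linear by simp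
  show ?thesis
    unfolding maj_row_def o_def
  proof (rule sum_swap_cols[of "row lam k" "\<lambda>\<alpha> x. int (ht lam x - k + 1) * of_bool (1 < k \<and> Ind \<alpha> (v x))"])
    show "int (ht lam i - k + 1) * of_bool (1 < k \<and> Ind (u (Suc i)) (v i)) +
      int (ht lam (Suc i) - k + 1) * of_bool (1 < k \<and> Ind (u i) (v (Suc i))) =
      int (ht lam i - k + 1) * of_bool (1 < k \<and> Ind (u i) (v i)) +
      int (ht lam (Suc i) - k + 1) * of_bool (1 < k \<and> Ind (u (Suc i)) (v (Suc i)))"
      using arg_cong[OF q, of "\<lambda>z. int (r - k + 1) * (of_bool (1 < k) * z)"] cols
      by (simp add: algebra_simps of_bool_conj del: of_nat_add of_nat_Suc)
  qed (use assms mem_row_cols finite_row in auto)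
qed

text \<open>\<open>s\<close> preserves the order of every pair of columns other than
  \<open>(i, Suc i)\<close>, so it permutes the remaining triples of the row.\<close>

lemma quinv_row_swap_both:
  assumes "1 \<le> k" "k \<le> r"
  shows "quinv_row lam k (u \<circ> s) (v \<circ> s) + of_bool (qtriple (u i) (v i) (v (Suc i))) =
    quinv_row lam k u v + of_bool (qtriple (u (Suc i)) (v (Suc i)) (v i))"
proof -
  define S where "S = (SIGMA x:row lam k. {y \<in> row lam k. x < y})"
  have fin: "finite S" unfolding S_def by (auto simp: finite_row)
  have mem: "(i, Suc i) \<in> S" using assms mem_row_cols by (auto simp: S_def)
  have "(\<Sum>(x, y)\<in>S - {(i, Suc i)}. of_bool (qtriple (u (s x)) (v (s x)) (v (s y))) :: int) =
     (\<Sum>(x, y)\<in>S - {(i, Suc i)}. of_bool (qtriple (u x) (v x) (v y)))"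
    by (rule sum.reindex_bij_witness[of _ "map_prod s s" "map_prod s s"])
      (auto simp: S_def transpose_eq_iff dest: s_less)
  then show ?thesis
    unfolding quinv_row_def S_def[symmetric] o_def
    by (subst (1 2) sum.remove[OF fin mem]) simp
qed

lemma quinv_row_swap_both_above:
  assumes "r < k"
  shows "quinv_row lam k (u \<circ> s) (v \<circ> s) = quinv_row lam k u v"
proof -
  have "s x = x" if "x \<in> row lam k" for x
    using that assms mem_row_cols[of k] by (auto simp: transpose_def)
  then show ?thesis
    unfolding quinv_row_def by (intro sum.cong refl) auto
qed

text \<open>The triple of the two columns is covered by the hypothesis. With a third column to their
  right, the two linear formulas add up to an expression symmetric in the exchanged letters; triples
  with another left column do not involve these letters.\<close>

lemma quinv_row_swap_top:
  assumes "qtriple (u i) (v i) (v (Suc i)) \<longleftrightarrow> qtriple (u (Suc i)) (v i) (v (Suc i))"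
    and "1 \<le> k" "k \<le> r"
  shows "quinv_row lam k (u \<circ> s) v = quinv_row lam k u v"
proof -
  have q: "(of_bool (Ind (u (Suc i)) (v i)) :: int) + of_bool (Ind (u i) (v (Suc i))) =
      of_bool (Ind (u i) (v i)) + of_bool (Ind (u (Suc i)) (v (Suc i)))"
    using arg_cong[OF assms(1), of "of_bool :: _ \<Rightarrow> int"] unfolding qtriple_linear by simp
  define f :: "letter \<Rightarrow> nat \<Rightarrow> int"
    where "f \<alpha> x = (\<Sum>y\<in>{y \<in> row lam k. x < y}. of_bool (qtriple \<alpha> (v x) (v y)))" for \<alpha> x
  have f: "quinv_row lam k u v = (\<Sum>x\<in>row lam k. f (u x) x)" for u
    unfolding quinv_row_def f_def by (subst sum.Sigma) (auto simp: finite_row)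
  define Y where "Y = {y \<in> row lam k. Suc i < y}"
  have "{y \<in> row lam k. i < y} = insert (Suc i) Y"
    using mem_row_cols assms by (auto simp: Y_def)
  then have fi: "f \<alpha> i = of_bool (qtriple \<alpha> (v i) (v (Suc i))) +
      (\<Sum>y\<in>Y. of_bool (qtriple \<alpha> (v i) (v y)))" for \<alpha>
    unfolding f_def by (simp add: Y_def finite_row)
  have "(\<Sum>y\<in>Y. of_bool (qtriple (u (Suc i)) (v i) (v y)) + of_bool (qtriple (u i) (v (Suc i)) (v y)) :: int) =
      (\<Sum>y\<in>Y. of_bool (qtriple (u i) (v i) (v y)) + of_bool (qtriple (u (Suc i)) (v (Suc i)) (v y)))"
    by (intro sum.cong refl) (use q in \<open>simp add: qtriple_linear\<close>)
  then have "f (u (Suc i)) i + f (u i) (Suc i) = f (u i) i + f (u (Suc i)) (Suc i)"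
    unfolding fi using assms(1) by (simp add: f_def sum.distrib flip: Y_def)
  then show ?thesis
    unfolding f o_def using assms mem_row_cols finite_row by (intro sum_swap_cols) auto
qed

text \<open>The exchange starts in the top row of the two columns and continues downwards as long as
  exchanging the entries above would change the status of the triple in the next row.\<close>

definition continues :: "(nat \<times> nat \<Rightarrow> letter) \<Rightarrow> nat \<Rightarrow> bool" where
  "continues \<sigma> k \<longleftrightarrow> (qtriple (\<sigma> (Suc k, i)) (\<sigma> (k, i)) (\<sigma> (k, Suc i)) \<noteq>
                   qtriple (\<sigma> (Suc k, Suc i)) (\<sigma> (k, i)) (\<sigma> (k, Suc i)))"

text \<open>Vacuously true for \<open>k \<ge> r\<close>: row \<open>r\<close> is always exchanged,
  and the two columns do not reach higher.\<close>

definition swapped :: "(nat \<times> nat \<Rightarrow> letter) \<Rightarrow> nat \<Rightarrow> bool" where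
  "swapped \<sigma> k \<longleftrightarrow> (\<forall>l. k \<le> l \<and> l < r \<longrightarrow> continues \<sigma> l)"

definition swap_cell :: "(nat \<times> nat \<Rightarrow> letter) \<Rightarrow> nat \<times> nat \<Rightarrow> nat \<times> nat" where
  "swap_cell \<sigma> u = (fst u, if swapped \<sigma> (fst u) then s (snd u) else snd u)"

definition swap_cols :: "(nat \<times> nat \<Rightarrow> letter) \<Rightarrow> nat \<times> nat \<Rightarrow> letter" where
  "swap_cols \<sigma> = \<sigma> \<circ> swap_cell \<sigma>"

text \<open>If both lower letters are \<open>b\<close>, the status of the triple is
  \<open>Ind b b\<close>, whatever stands above.\<close>

lemma continues_distinct: "continues \<sigma> k \<Longrightarrow> \<sigma> (k, i) \<noteq> \<sigma> (k, Suc i)"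
proof
  assume *: "continues \<sigma> k" "\<sigma> (k, i) = \<sigma> (k, Suc i)"
  have "(of_bool (qtriple c b b) :: int) = of_bool (Ind b b)" for c b
    by (simp add: qtriple_linear)
  then have "qtriple c b b = Ind b b" for c b by (metis of_bool_eq_iff)
  then show False using * by (simp add: continues_def)
qed

lemma swapped_Suc: "swapped \<sigma> k \<Longrightarrow> swapped \<sigma> (Suc k)"
  by (simp add: swapped_def)

lemma swap_cell_mem_dg [simp]: "swap_cell \<sigma> u \<in> dg lam \<longleftrightarrow> u \<in> dg lam"
  by (cases u) (simp add: swap_cell_def)

lemma fst_swap_cell [simp]: "fst (swap_cell \<sigma> u) = fst u"
  by (simp add: swap_cell_def)

lemma swap_cell_swap_cell [simp]: "swap_cell \<sigma> (swap_cell \<sigma> u) = u"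
  by (simp add: swap_cell_def)

lemma bij_swap_cell: "bij_betw (swap_cell \<sigma>) (dg lam) (dg lam)"
  by (rule bij_betw_byWitness[of _ "swap_cell \<sigma>"]) auto

lemma super_filling_swap_cols: "super_filling lam \<sigma> \<Longrightarrow> super_filling lam (swap_cols \<sigma>)"
  unfolding super_filling_def swap_cols_def o_def by (metis swap_cell_mem_dg)

text \<open>Exchanging the lower letters as well reverses the status of both triples, so whether
  they differ is unaffected. A second exchange therefore stops in the same row, which makes
  \<open>swap_cols\<close> an involution.\<close>

lemma continues_swap_cols:
  assumes "swapped \<sigma> (Suc k)"
  shows "continues (swap_cols \<sigma>) k \<longleftrightarrow> continues \<sigma> k"
proof (cases "\<sigma> (k, i) = \<sigma> (k, Suc i)")
  case True
  then have "\<not> continues \<sigma> k" "\<not> continues (swap_cols \<sigma>) k"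
    using continues_distinct[of \<sigma> k] continues_distinct[of "swap_cols \<sigma>" k]
    by (auto simp: swap_cols_def swap_cell_def split: if_splits)
  then show ?thesis by simp
next
  case False
  then show ?thesis
    using assms qtriple_swap[OF False]
    by (auto simp: continues_def swap_cols_def swap_cell_def)
qed

lemma swapped_swap_cols: "swapped (swap_cols \<sigma>) k \<longleftrightarrow> swapped \<sigma> k"
proof (cases "k < r")
  case True
  then have "k \<le> r" by simp
  then show ?thesis
  proof (induction rule: inc_induct)
    case base
    show ?case by (auto simp: swapped_def)
  next
    case (step l)
    have "swapped \<tau> l \<longleftrightarrow> continues \<tau> l \<and> swapped \<tau> (Suc l)" for \<tau>
      using step.hyps by (auto simp: swapped_def le_Suc_eq not_less_eq_eq) (metis Suc_leI le_neq_implies_less)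
    then show ?case using step.IH continues_swap_cols by blast
  qed
qed (auto simp: swapped_def)

lemma swap_cols_swap_cols [simp]: "swap_cols (swap_cols \<sigma>) = \<sigma>"
proof
  fix u
  have "swap_cell (swap_cols \<sigma>) = swap_cell \<sigma>"
    by (auto simp: swap_cell_def swapped_swap_cols fun_eq_iff)
  then show "swap_cols (swap_cols \<sigma>) u = \<sigma> u"
    unfolding swap_cols_def[of "swap_cols \<sigma>"] by (simp add: swap_cols_def)
qed

lemma content_swap_cols: "content lam (swap_cols \<sigma>) = content lam \<sigma>"
proof -
  have "content lam (swap_cols \<sigma>) =
      image_mset (\<lambda>u. absv (\<sigma> u)) (image_mset (swap_cell \<sigma>) (mset_set (dg lam)))"
    by (simp add: content_def swap_cols_def multiset.map_comp o_def)
  also have "image_mset (swap_cell \<sigma>) (mset_set (dg lam)) = mset_set (dg lam)"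
    using bij_swap_cell by (metis bij_betw_def image_mset_mset_set)
  finally show ?thesis by (simp add: content_def)
qed

lemma card_swap_cols: "card {u \<in> dg lam. p (swap_cols \<sigma> u)} = card {u \<in> dg lam. p (\<sigma> u)}"
  by (rule bij_betw_same_card[of "swap_cell \<sigma>"], rule bij_betw_byWitness[of _ "swap_cell \<sigma>"])
    (auto simp: swap_cols_def)

lemma row_swap_cols:
  "(\<lambda>x. swap_cols \<sigma> (k, x)) =
     (if swapped \<sigma> k then (\<lambda>x. \<sigma> (k, x)) \<circ> s else (\<lambda>x. \<sigma> (k, x)))"
  by (auto simp: swap_cols_def swap_cell_def)

text \<open>Two consecutive rows are both exchanged, both left alone, or separated by the end of the
  exchange. In the last case the stopping criterion is the hypothesis of
  \<open>maj_row_swap_top\<close>.\<close>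

lemma maj_swap_cols: "maj lam (swap_cols \<sigma>) = maj lam \<sigma>"
proof -
  have "maj_row lam k (\<lambda>x. swap_cols \<sigma> (k, x)) (\<lambda>x. swap_cols \<sigma> (k - 1, x)) =
      maj_row lam k (\<lambda>x. \<sigma> (k, x)) (\<lambda>x. \<sigma> (k - 1, x))" if "k \<ge> 1" for k
  proof (cases "swapped \<sigma> (k - 1)")
    case True
    then have "swapped \<sigma> k" using swapped_Suc[of \<sigma> "k - 1"] that by simp
    then show ?thesis using True maj_row_swap_both by (simp add: row_swap_cols)
  next
    case False
    show ?thesis
    proof (cases "swapped \<sigma> k")
      case sw: True
      then have "k - 1 < r" "\<not> continues \<sigma> (k - 1)"
        using False that by (auto simp: swapped_def)
          (metis Suc_pred' le_neq_implies_less less_eq_Suc_le less_one not_le le_eq_less_or_eq)+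
      then show ?thesis
        using False sw that maj_row_swap_top[of "\<lambda>x. \<sigma> (k, x)" "\<lambda>x. \<sigma> (k - 1, x)" k]
        by (auto simp: row_swap_cols continues_def)
    qed (use False in \<open>simp add: row_swap_cols\<close>)
  qed
  moreover have "k \<ge> 1" if "k \<in> fst ` dg lam" for k using that by (auto simp: dg_def)
  ultimately have "int (maj lam (swap_cols \<sigma>)) = int (maj lam \<sigma>)"
    unfolding maj_eq_sum_rows by (intro sum.cong refl) blast
  then show ?thesis by simp
qed

text \<open>Where a row below \<open>r\<close> is exchanged, exchanging the upper letters flips the
  status of the triple of the two columns, and exchanging the lower letters flips it back. Only row
  \<open>r\<close> contributes a change, since the triple there is degenerate.\<close>

lemma quinv_swap_cols:
  assumes "super_filling lam \<sigma>"
  shows "quinv lam (swap_cols \<sigma>) + of_bool (Ind (\<sigma> (r, Suc i)) (\<sigma> (r, i))) =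
         quinv lam \<sigma> + of_bool (Ind (\<sigma> (r, i)) (\<sigma> (r, Suc i)))"
proof -
  let ?F = "\<lambda>\<sigma> k. quinv_row lam k (\<lambda>x. \<sigma> (Suc k, x)) (\<lambda>x. \<sigma> (k, x))"
  have *: "?F (swap_cols \<sigma>) k = ?F \<sigma> k" if k: "1 \<le> k" "k \<noteq> r" for k
  proof (cases "swapped \<sigma> k")
    case True
    then have sw: "swapped \<sigma> (Suc k)" by (rule swapped_Suc)
    show ?thesis
    proof (cases "k < r")
      case lt: True
      then have "continues \<sigma> k" using True by (simp add: swapped_def)
      then have "qtriple (\<sigma> (Suc k, i)) (\<sigma> (k, i)) (\<sigma> (k, Suc i)) =
          qtriple (\<sigma> (Suc k, Suc i)) (\<sigma> (k, Suc i)) (\<sigma> (k, i))"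
        using continues_distinct[of \<sigma> k] qtriple_swap[of "\<sigma> (k, i)" "\<sigma> (k, Suc i)"]
        by (auto simp: continues_def)
      then show ?thesis
        using True sw lt k quinv_row_swap_both[of k "\<lambda>x. \<sigma> (Suc k, x)" "\<lambda>x. \<sigma> (k, x)"]
        by (simp add: row_swap_cols)
    qed (use True sw k quinv_row_swap_both_above in \<open>simp add: row_swap_cols\<close>)
  next
    case False
    show ?thesis
    proof (cases "swapped \<sigma> (Suc k)")
      case sw: True
      then have "k < r \<and> \<not> continues \<sigma> k"
        using False by (auto simp: swapped_def) (metis Suc_leI le_neq_implies_less order_le_less_trans)+
      then show ?thesis
        using False sw k quinv_row_swap_top[of "\<lambda>x. \<sigma> (Suc k, x)" "\<lambda>x. \<sigma> (k, x)" k]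
        by (auto simp: row_swap_cols continues_def)
    qed (use False in \<open>simp add: row_swap_cols\<close>)
  qed
  have zero: "\<sigma> (Suc r, i) = Zero" "\<sigma> (Suc r, Suc i) = Zero"
    using assms cols by (auto simp: super_filling_def dg_def)
  have sw: "swapped \<sigma> r" "swapped \<sigma> (Suc r)" by (auto simp: swapped_def)
  have top: "?F (swap_cols \<sigma>) r + of_bool (Ind (\<sigma> (r, Suc i)) (\<sigma> (r, i))) =
      ?F \<sigma> r + of_bool (Ind (\<sigma> (r, i)) (\<sigma> (r, Suc i)))"
    using quinv_row_swap_both[of r "\<lambda>x. \<sigma> (Suc r, x)" "\<lambda>x. \<sigma> (r, x)"] sw cols
    by (simp add: row_swap_cols zero qtriple_Zero)
  have r: "r \<in> fst ` dg lam" using cols by (force simp: dg_def image_iff)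
  have rows: "k \<ge> 1" if "k \<in> fst ` dg lam" for k using that by (auto simp: dg_def)
  have fin: "finite (fst ` dg lam)" by (simp add: finite_dg)
  have rest: "(\<Sum>k\<in>fst ` dg lam - {r}. ?F (swap_cols \<sigma>) k) = (\<Sum>k\<in>fst ` dg lam - {r}. ?F \<sigma> k)"
    using rows by (intro sum.cong refl *) auto
  have "int (quinv lam (swap_cols \<sigma>)) + of_bool (Ind (\<sigma> (r, Suc i)) (\<sigma> (r, i))) =
         int (quinv lam \<sigma>) + of_bool (Ind (\<sigma> (r, i)) (\<sigma> (r, Suc i)))"
    unfolding quinv_eq_sum_rows[OF assms] quinv_eq_sum_rows[OF super_filling_swap_cols[OF assms]]
    using top rest sum.remove[OF fin r, of "?F \<sigma>"] sum.remove[OF fin r, of "?F (swap_cols \<sigma>)"]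
    by simp
  then show ?thesis by (simp flip: of_nat_eq_iff[where 'a = int])
qed

end

subsection \<open>Fillings with prescribed distinguished label and row\<close>

lemma ht_antimono:
  assumes "is_partition lam" "1 \<le> x" "x \<le> y" "y \<le> length lam"
  shows "ht lam y \<le> ht lam x"
proof (cases "x = y")
  case False
  then show ?thesis
    using assms sorted_wrt_nth_less[of "(\<ge>)" lam "x - 1" "y - 1"]
    by (auto simp: is_partition_def ht_def)
qed simp

definition big :: "nat \<Rightarrow> letter \<Rightarrow> bool" where
  "big a x \<longleftrightarrow> x \<noteq> Zero \<and> a \<le> absv x"

lemma Ind_extremal:
  assumes "big a x"
  shows "\<not> Ind (Pos a) x" "Ind (Neg a) x"
    and "absv x \<noteq> a \<Longrightarrow> Ind x (Pos a)" "absv x \<noteq> a \<Longrightarrow> \<not> Ind x (Neg a)"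
  using assms by (cases x; auto simp: big_def Ind_def)+

text \<open>Both comparisons of the top letter rise from 0 to 1, and they have opposite signs in the
  linear formula.\<close>

lemma qtriple_flip_top:
  assumes "big a b" "big a c"
  shows "qtriple (Neg a) b c = qtriple (Pos a) b c"
proof -
  have "of_bool (qtriple (Neg a) b c) = (of_bool (qtriple (Pos a) b c) :: int)"
    unfolding qtriple_linear using Ind_extremal assms by simp
  then show ?thesis by (simp only: of_bool_eq_iff)
qed

text \<open>The comparison with \<open>b\<close> rises from 0 to 1, and the one with
  \<open>e\<close> drops from 1 to 0; the drop relies on \<open>absv e \<noteq> a\<close>.\<close>

lemma qtriple_flip_right:
  assumes "big a e" "absv e \<noteq> a" "big a b"
  shows "qtriple e b (Neg a) = qtriple e b (Pos a)"
proof -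
  have "of_bool (qtriple e b (Neg a)) = (of_bool (qtriple e b (Pos a)) :: int)"
    unfolding qtriple_linear using Ind_extremal assms by simp
  then show ?thesis by (simp only: of_bool_eq_iff)
qed

text \<open>Only the label and the row of the distinguished cell are fixed, because exchanging
  columns can move the cell within its row. For a partition, it is enough that some \<open>a\<close>
  in row \<open>r\<close> tops a column of height \<open>r\<close>: the distinguished cell lies
  weakly to its right, hence in a column of the same height.\<close>

definition label_row_class ::
    "nat list \<Rightarrow> nat multiset \<Rightarrow> nat \<Rightarrow> nat \<Rightarrow> (nat \<times> nat \<Rightarrow> letter) set" where
  "label_row_class lam \<mu> a r = {\<sigma>. super_filling lam \<sigma> \<and> content lam \<sigma> = \<mu> \<and>
     (\<forall>u\<in>dg lam. absv (\<sigma> u) < a \<longrightarrow> fst u \<le> absv (\<sigma> u)) \<and>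
     (\<forall>u\<in>dg lam. r < fst u \<longrightarrow> absv (\<sigma> u) \<noteq> a) \<and>
     (\<exists>j. (r, j) \<in> dg lam \<and> ht lam j = r \<and> absv (\<sigma> (r, j)) = a)}"

lemma absv_mem_content: "u \<in> dg lam \<Longrightarrow> absv (\<sigma> u) \<in># content lam \<sigma>"
  by (simp add: content_def finite_dg)

lemma super_filling_nonzero:
  assumes "super_filling lam \<sigma>" "u \<in> dg lam"
  shows "\<sigma> u \<noteq> Zero" "absv (\<sigma> u) > 0"
  using assms by (fastforce simp: super_filling_def)+

lemma finite_fillings: "finite {\<sigma>. super_filling lam \<sigma> \<and> content lam \<sigma> = \<mu>}"
proof -
  let ?B = "Pos ` set_mset \<mu> \<union> Neg ` set_mset \<mu>"
  have "{\<sigma>. super_filling lam \<sigma> \<and> content lam \<sigma> = \<mu>} \<subseteq>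
      {\<sigma>. \<forall>u. (u \<in> dg lam \<longrightarrow> \<sigma> u \<in> ?B) \<and> (u \<notin> dg lam \<longrightarrow> \<sigma> u = Zero)}"
  proof (intro subsetI CollectI allI conjI impI)
    fix \<sigma> u assume \<sigma>: "\<sigma> \<in> {\<sigma>. super_filling lam \<sigma> \<and> content lam \<sigma> = \<mu>}"
    show "\<sigma> u \<in> ?B" if "u \<in> dg lam"
      using absv_mem_content[OF that, of \<sigma>] super_filling_nonzero[OF _ that, of \<sigma>] \<sigma>
      by (cases "\<sigma> u") auto
    show "\<sigma> u = Zero" if "u \<notin> dg lam"
      using that \<sigma> unfolding super_filling_def by blast
  qed
  then show ?thesis
    by (rule finite_subset) (intro finite_set_of_finite_funs finite_dg; simp)
qed

lemma finite_label_row_class: "finite (label_row_class lam \<mu> a r)"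
  by (rule finite_subset[OF _ finite_fillings[of lam \<mu>]]) (auto simp: label_row_class_def)

text \<open>Reading from right to left puts the right column of each pair first, as
  \<open>qtriple_Zero\<close> requires. The induction prepends column \<open>c + n\<close>.\<close>

lemma coinv_eq_card:
  "coinv (map f (rev [c..<c + n])) = card {(x, y). c \<le> x \<and> x < y \<and> y < c + n \<and> Ind (f y) (f x)}"
proof (induction n)
  case (Suc n)
  let ?S = "\<lambda>n. {(x, y). c \<le> x \<and> x < y \<and> y < c + n \<and> Ind (f y) (f x)}"
  let ?N = "{x \<in> {c..<c + n}. Ind (f (c + n)) (f x)}"
  have "?S n \<subseteq> {c..<c + n} \<times> {c..<c + n}" by auto
  then have fin: "finite (?S n)" by (rule finite_subset) auto
  have "?S (Suc n) = ?S n \<union> (\<lambda>x. (x, c + n)) ` ?N"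
    by (auto simp: less_Suc_eq image_iff)
  then have "card (?S (Suc n)) = card (?S n) + card ((\<lambda>x. (x, c + n)) ` ?N)"
    using fin by (simp only:) (rule card_Un_disjoint, auto)
  also have "card ((\<lambda>x. (x, c + n)) ` ?N) = card ?N"
    by (rule card_image) (auto simp: inj_on_def)
  also have "card ?N = length (filter (Ind (f (c + n))) (map f (rev [c..<c + n])))"
    by (simp add: filter_map o_def distinct_length_filter Int_def conj_commute)
  finally show ?case using Suc.IH by simp
qed (auto simp: card_eq_0_iff)

section \<open>Vanishing of the sum for a fixed label and row\<close>

locale block =
  fixes lam :: "nat list" and \<mu> :: "nat multiset" and a r c n :: nat and q t :: "'r::comm_ring_1"
  assumes part: "is_partition lam" and a: "0 < a" "a < r" and n: "0 < n"
    and block_iff: "\<And>j. (r, j) \<in> dg lam \<and> ht lam j = r \<longleftrightarrow> c \<le> j \<and> j < c + n"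
begin

abbreviation "cls \<equiv> label_row_class lam \<mu> a r"

definition word :: "(nat \<times> nat \<Rightarrow> letter) \<Rightarrow> letter list" where
  "word \<sigma> = map (\<lambda>j. \<sigma> (r, j)) (rev [c..<c + n])"

text \<open>The contribution of the degenerate triples inside the block is removed. The subtraction
  in the exponent is exact by \<open>coinv_word_le_quinv\<close>.\<close>

definition word_sum :: "letter list \<Rightarrow> 'r" where
  "word_sum w = (\<Sum>\<sigma>\<in>{\<sigma> \<in> cls. word \<sigma> = w}.
     (- 1) ^ mcount lam \<sigma> * q ^ (pcount lam \<sigma> + maj lam \<sigma>) * t ^ (quinv lam \<sigma> - coinv w))"

lemma cls_super_filling: "\<sigma> \<in> cls \<Longrightarrow> super_filling lam \<sigma>"
  by (simp add: label_row_class_def)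

text \<open>In the class, an entry of absolute value \<open>b < a\<close> lies in a row at most
  \<open>b\<close>, hence below row \<open>a\<close>.\<close>

lemma cls_big: "\<sigma> \<in> cls \<Longrightarrow> (k, j) \<in> dg lam \<Longrightarrow> a \<le> k \<Longrightarrow> big a (\<sigma> (k, j))"
  using super_filling_nonzero[of lam \<sigma> "(k, j)"]
  by (fastforce simp: label_row_class_def big_def)

lemma cls_above: "\<sigma> \<in> cls \<Longrightarrow> (k, j) \<in> dg lam \<Longrightarrow> r < k \<Longrightarrow> absv (\<sigma> (k, j)) \<noteq> a"
  by (auto simp: label_row_class_def)

lemma coinv_word_le_quinv:
  assumes "super_filling lam \<sigma>"
  shows "coinv (word \<sigma>) \<le> quinv lam \<sigma>"
proof -
  let ?S = "{(x, y). c \<le> x \<and> x < y \<and> y < c + n \<and> Ind (\<sigma> (r, y)) (\<sigma> (r, x))}"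
  have "(\<lambda>(x, y). (r, x, y)) ` ?S \<subseteq> {x \<in> triples lam. quinv_triple lam \<sigma> x}"
  proof clarify
    fix x y assume *: "c \<le> x" "x < y" "y < c + n" "Ind (\<sigma> (r, y)) (\<sigma> (r, x))"
    then have xy: "(r, x) \<in> dg lam" "ht lam x = r" "(r, y) \<in> dg lam"
      using block_iff[of x] block_iff[of y] by auto
    then have "\<sigma> (Suc r, x) = Zero" using assms by (auto simp: super_filling_def dg_def)
    then show "(r, x, y) \<in> triples lam \<and> quinv_triple lam \<sigma> (r, x, y)"
      using * xy
      by (auto simp: triples_def quinv_triple_eq[OF assms] qtriple_Zero)
  qed
  then have "card ((\<lambda>(x, y). (r, x, y)) ` ?S) \<le> quinv lam \<sigma>"
    unfolding quinv_def by (intro card_mono) (auto simp: finite_triples)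
  also have "card ((\<lambda>(x, y). (r, x, y)) ` ?S) = card ?S"
    by (rule card_image) (auto simp: inj_on_def)
  finally show ?thesis by (simp add: word_def coinv_eq_card)
qed

text \<open>\<open>swap_cols\<close> is a bijection between the two index sets. It changes
  \<open>quinv\<close> exactly as the swap of letters changes \<open>coinv\<close>, and preserves
  the other statistics.\<close>

lemma word_sum_swap: "word_sum (u @ x # y # v) = word_sum (u @ y # x # v)"
proof (cases "length (u @ x # y # v) = n")
  case False
  then have "{\<sigma> \<in> cls. word \<sigma> = u @ x # y # v} = {}" "{\<sigma> \<in> cls. word \<sigma> = u @ y # x # v} = {}"
    by (auto simp: word_def dest: arg_cong[where f = length])
  then show ?thesis unfolding word_sum_def by (simp only: sum.empty)
next
  case True
  \<comment> \<open>The word runs from right to left, so \<open>y\<close> stands in column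
    \<open>i\<close> and \<open>x\<close> in column \<open>Suc i\<close>.\<close>
  define i where "i = c + length v"
  have n: "n = length u + 2 + length v" using True by simp
  interpret adjacent_columns lam i r
    using block_iff[of i] block_iff[of "Suc i"] n by unfold_locales (auto simp: i_def dg_def)
  have "[c..<c + n] = [c..<i] @ i # Suc i # [Suc (Suc i)..<c + n]"
    using n upt_add_eq_append[of c i "length u + 2"] upt_conv_Cons[of i "c + n"]
      upt_conv_Cons[of "Suc i" "c + n"]
    by (simp add: i_def add_ac)
  then have word: "word \<sigma> = map (\<lambda>j. \<sigma> (r, j)) (rev [Suc (Suc i)..<c + n]) @
      \<sigma> (r, Suc i) # \<sigma> (r, i) # map (\<lambda>j. \<sigma> (r, j)) (rev [c..<i])" for \<sigma>
    by (simp add: word_def)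
  have word_iff: "word \<sigma> = u' @ x' # y' # v' \<longleftrightarrow> map (\<lambda>j. \<sigma> (r, j)) (rev [Suc (Suc i)..<c + n]) = u' \<and>
      \<sigma> (r, Suc i) = x' \<and> \<sigma> (r, i) = y' \<and> map (\<lambda>j. \<sigma> (r, j)) (rev [c..<i]) = v'"
    if "length u' = length u" for \<sigma> u' x' y' v'
  proof -
    have "length (map (\<lambda>j. \<sigma> (r, j)) (rev [Suc (Suc i)..<c + n])) = length u'"
      using that n unfolding i_def length_map length_rev length_upt by linarith
    then show ?thesis unfolding word by (subst append_eq_append_conv) (rule disjI1, auto)
  qed
  have top: "swap_cols \<sigma> (r, j) = \<sigma> (r, s j)" for \<sigma> j
    by (auto simp: swap_cols_def swap_cell_def swapped_def)
  have word_swap: "word (swap_cols \<sigma>) = u @ y' # x' # v" if "word \<sigma> = u @ x' # y' # v" for \<sigma> x' y'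
  proof -
    have "map (\<lambda>j. swap_cols \<sigma> (r, j)) (rev [Suc (Suc i)..<c + n]) =
        map (\<lambda>j. \<sigma> (r, j)) (rev [Suc (Suc i)..<c + n])"
      "map (\<lambda>j. swap_cols \<sigma> (r, j)) (rev [c..<i]) = map (\<lambda>j. \<sigma> (r, j)) (rev [c..<i])"
      by (auto simp: top transpose_def)
    then show ?thesis using that by (simp only: word_iff) (simp add: top)
  qed
  have cls_swap: "swap_cols \<sigma> \<in> cls" if \<sigma>: "\<sigma> \<in> cls" for \<sigma>
  proof -
    have 1: "\<forall>u\<in>dg lam. absv (\<sigma> u) < a \<longrightarrow> fst u \<le> absv (\<sigma> u)"
      "\<forall>u\<in>dg lam. r < fst u \<longrightarrow> absv (\<sigma> u) \<noteq> a" using that by (auto simp: label_row_class_def)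
    obtain j where j: "(r, j) \<in> dg lam" "ht lam j = r" "absv (\<sigma> (r, j)) = a"
      using \<sigma> by (auto simp: label_row_class_def)
    then have "(r, s j) \<in> dg lam" "ht lam (s j) = r" "absv (swap_cols \<sigma> (r, s j)) = a"
      by (auto simp: top)
    moreover have "\<forall>u\<in>dg lam. absv (swap_cols \<sigma> u) < a \<longrightarrow> fst u \<le> absv (swap_cols \<sigma> u)"
      "\<forall>u\<in>dg lam. r < fst u \<longrightarrow> absv (swap_cols \<sigma> u) \<noteq> a"
      unfolding swap_cols_def o_def using 1 by (metis fst_swap_cell swap_cell_mem_dg)+
    ultimately show ?thesis
      using that super_filling_swap_cols[of \<sigma>] content_swap_cols[of \<sigma>]
      unfolding label_row_class_def by blast
  qed
  show ?thesis
    unfolding word_sum_def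
  proof (rule sum.reindex_bij_witness[of _ swap_cols swap_cols], goal_cases)
    case (5 \<sigma>)
    then have w: "word \<sigma> = u @ x # y # v" and sf: "super_filling lam \<sigma>"
      by (auto simp: cls_super_filling)
    have "quinv lam (swap_cols \<sigma>) + of_bool (Ind x y) = quinv lam \<sigma> + of_bool (Ind y x)"
      using quinv_swap_cols[OF sf] w by (simp add: word_iff)
    then have "quinv lam (swap_cols \<sigma>) - coinv (u @ y # x # v) = quinv lam \<sigma> - coinv (u @ x # y # v)"
      using coinv_swap[of u y x v] by (auto simp: of_bool_def split: if_splits)
    then show ?case
      by (simp add: maj_swap_cols pcount_def mcount_def card_swap_cols)
  qed (use cls_swap word_swap in auto)
qed

text \<open>The letter at the top of the rightmost block column is changed. This moves one unit from
  \<open>pcount\<close> to \<open>maj\<close> and raises \<open>quinv\<close> and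
  \<open>coinv\<close> by \<open>n - 1\<close> each, so only the sign remains.\<close>

lemma word_sum_flip: "word_sum (Neg a # w) = - word_sum (Pos a # w)"
proof -
  define d where "d = c + n - 1"
  have d: "c \<le> d" "Suc d = c + n" "d - c = n - 1" using n by (auto simp: d_def)
  have dd: "(r, d) \<in> dg lam" "ht lam d = r" using block_iff[of d] d by auto
  have rev: "rev [c..<c + n] = d # rev [c..<d]" unfolding d(2)[symmetric] using d(1) by simp
  have word_iff: "word \<sigma> = x # v \<longleftrightarrow> \<sigma> (r, d) = x \<and> map (\<lambda>j. \<sigma> (r, j)) (rev [c..<d]) = v" for \<sigma> x v
    by (simp add: word_def rev)
  \<comment> \<open>Hence \<open>(r, d)\<close> is never the lower left cell of a triple.\<close>
  have right: "y \<le> d" if "(r, y) \<in> dg lam" for y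
  proof (rule ccontr)
    assume "\<not> y \<le> d"
    then have "ht lam y \<le> ht lam d" using that dd by (intro ht_antimono[OF part]) (auto simp: dg_def)
    then have "ht lam y = r" using that dd by (auto simp: dg_def)
    then show False using block_iff[of y] that d \<open>\<not> y \<le> d\<close> by auto
  qed
  let ?f = "\<lambda>x \<sigma>. \<sigma>((r, d) := x)"
  have cls_flip: "?f x \<sigma> \<in> cls \<and> word (?f x \<sigma>) = x # w"
    if "\<sigma> \<in> cls" "word \<sigma> = y # w" "absv y = a" "x = Pos a \<or> x = Neg a" for \<sigma> x y
  proof -
    have abs: "absv (?f x \<sigma> u) = absv (\<sigma> u)" for u
      using that by (auto simp: word_iff)
    have "super_filling lam (?f x \<sigma>)"
      using that dd a cls_super_filling[of \<sigma>] unfolding super_filling_def by auto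
    moreover have "content lam (?f x \<sigma>) = content lam \<sigma>" by (simp only: content_def abs)
    ultimately have "?f x \<sigma> \<in> cls" using that(1) unfolding label_row_class_def mem_Collect_eq abs by auto
    moreover have "map (\<lambda>j. ?f x \<sigma> (r, j)) (rev [c..<d]) = map (\<lambda>j. \<sigma> (r, j)) (rev [c..<d])" by auto
    ultimately show ?thesis using that(2) by (auto simp: word_iff)
  qed
  have "word_sum (Neg a # w) = (\<Sum>\<sigma>\<in>{\<sigma> \<in> cls. word \<sigma> = Pos a # w}. - ((- 1) ^ mcount lam \<sigma> *
      q ^ (pcount lam \<sigma> + maj lam \<sigma>) * t ^ (quinv lam \<sigma> - coinv (Pos a # w))))"
    unfolding word_sum_def
  proof (rule sum.reindex_bij_witness[of _ "?f (Pos a)" "?f (Neg a)", symmetric], goal_cases)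
    case (5 \<sigma>)
    define \<tau> where "\<tau> = ?f (Neg a) \<sigma>"
    have \<sigma>: "\<sigma> \<in> cls" "word \<sigma> = Pos a # w" "\<sigma> (r, d) = Pos a" using 5 by (auto simp: word_iff)
    note sf = cls_super_filling[OF \<sigma>(1)]
    have \<tau>cls: "\<tau> \<in> cls" using cls_flip[OF \<sigma>(1,2)] by (simp add: \<tau>_def)
    note sft = cls_super_filling[OF \<tau>cls]
    have \<tau>d: "\<tau> (r, d) = Neg a" and \<tau>o: "u \<noteq> (r, d) \<Longrightarrow> \<tau> u = \<sigma> u" for u
      by (auto simp: \<tau>_def)
    have m: "mcount lam \<tau> = Suc (mcount lam \<sigma>)"
    proof -
      have "{u \<in> dg lam. is_neg (\<tau> u)} = insert (r, d) {u \<in> dg lam. is_neg (\<sigma> u)}"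
        using dd by (auto simp: \<tau>_def)
      then show ?thesis using \<sigma>(3) by (simp add: mcount_def finite_dg)
    qed
    have p: "pcount lam \<sigma> = Suc (pcount lam \<tau>)"
    proof -
      have "{u \<in> dg lam. is_pos (\<sigma> u)} = insert (r, d) {u \<in> dg lam. is_pos (\<tau> u)}"
        using dd \<sigma>(3) by (auto simp: \<tau>_def)
      then show ?thesis using \<tau>d by (simp add: pcount_def finite_dg)
    qed
    have below: "(r - 1, d) \<in> dg lam" using dd a by (auto simp: dg_def)
    \<comment> \<open>Here \<open>a < r\<close> enters: row \<open>r - 1\<close> is still at least
      \<open>a\<close>.\<close>
    have big_below: "big a (\<sigma> (r - 1, d))" using cls_big[OF \<sigma>(1) below] a by simp
    have mj: "maj lam \<tau> = Suc (maj lam \<sigma>)"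
    proof -
      have nd: "\<not> descent lam \<sigma> (r, d)"
        using Ind_extremal(1)[OF big_below] \<sigma>(3) by (simp add: descent_def)
      have "{u \<in> dg lam. descent lam \<tau> u} = insert (r, d) {u \<in> dg lam. descent lam \<sigma> u}"
      proof (intro set_eqI)
        fix u :: "nat \<times> nat"
        obtain k j where u: "u = (k, j)" by fastforce
        have "descent lam \<tau> (r, d)"
          using Ind_extremal(2)[OF big_below] \<tau>d \<tau>o[of "(r - 1, d)"] a dd by (simp add: descent_def)
        moreover have "descent lam \<tau> u = descent lam \<sigma> u" if "u \<noteq> (r, d)" "u \<in> dg lam"
        proof -
          have "(k - 1, j) \<noteq> (r, d)" using that dd u by (auto simp: dg_def)
          then show ?thesis using \<tau>o that(1) u by (simp add: descent_def)
        qed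
        ultimately show "u \<in> {u \<in> dg lam. descent lam \<tau> u} \<longleftrightarrow>
            u \<in> insert (r, d) {u \<in> dg lam. descent lam \<sigma> u}" using dd by auto
      qed
      \<comment> \<open>The new descent has leg 0 and so adds exactly 1.\<close>
      then show ?thesis using nd dd by (simp add: maj_def finite_dg leg_def)
    qed
    have qv: "quinv lam \<tau> = quinv lam \<sigma> + (n - 1)"
    proof -
      \<comment> \<open>The degenerate triples joining column \<open>d\<close> to the other block
        columns; exactly these change status.\<close>
      let ?B = "(\<lambda>x. (r, x, d)) ` {c..<d}"
      have blockB: "T \<in> triples lam \<and> quinv_triple lam \<tau> T \<and> \<not> quinv_triple lam \<sigma> T" if "T \<in> ?B" for T
      proof -
        obtain x where x: "T = (r, x, d)" "c \<le> x" "x < d" using \<open>T \<in> ?B\<close> by auto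
        then have xd: "(r, x) \<in> dg lam" "ht lam x = r" using block_iff[of x] d by auto
        then have "\<sigma> (Suc r, x) = Zero" "\<tau> (Suc r, x) = Zero"
          using sf sft by (auto simp: super_filling_def dg_def)
        moreover have "big a (\<sigma> (r, x))" using cls_big[OF \<sigma>(1) xd(1)] a by simp
        moreover have "\<tau> (r, x) = \<sigma> (r, x)" using x by (simp add: \<tau>o)
        ultimately show ?thesis
          using x dd xd \<sigma>(3) \<tau>d Ind_extremal(1,2)[of a "\<sigma> (r, x)"]
          by (auto simp: quinv_triple_eq[OF sf] quinv_triple_eq[OF sft] triples_def qtriple_Zero big_def)
      qed
      have other: "quinv_triple lam \<tau> T = quinv_triple lam \<sigma> T" if mem: "T \<in> triples lam" and notin: "T \<notin> ?B" for T
      proof -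
        obtain k x y where T: "T = (k, x, y)" "x < y" "(k, x) \<in> dg lam" "(k, y) \<in> dg lam"
          using mem unfolding triples_def by blast
        have b: "(k, x) \<noteq> (r, d)" using right T by fastforce
        consider "(Suc k, x) = (r, d)" | "(k, y) = (r, d)" | "(Suc k, x) \<noteq> (r, d)" "(k, y) \<noteq> (r, d)"
          by blast
        then have "qtriple (\<tau> (Suc k, x)) (\<tau> (k, x)) (\<tau> (k, y)) =
            qtriple (\<sigma> (Suc k, x)) (\<sigma> (k, x)) (\<sigma> (k, y))"
        proof cases
          \<comment> \<open>The changed cell is the top of the triple, whose lower cells lie in row
            \<open>r - 1\<close>.\<close>
          case 1
          then have "(k, y) \<noteq> (r, d)" by auto
          then show ?thesis
            using 1 b \<tau>d \<sigma>(3) \<tau>o a T cls_big[OF \<sigma>(1)] qtriple_flip_top[of a "\<sigma> (k, x)" "\<sigma> (k, y)"]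
            by auto
        next
          \<comment> \<open>The changed cell is on the right. The left column lies outside the
            block, so it reaches row \<open>Suc r\<close>, where absolute value \<open>a\<close>
            does not occur.\<close>
          case 2
          have "\<not> (c \<le> x \<and> x < c + n)" using notin T(1,2) 2 by auto
          then have "ht lam x \<noteq> r" using block_iff[of x] T 2 by auto
          then have up: "(Suc r, x) \<in> dg lam" using T 2 by (auto simp: dg_def)
          then have "big a (\<sigma> (Suc r, x))" "absv (\<sigma> (Suc r, x)) \<noteq> a" "big a (\<sigma> (r, x))"
            using cls_big[OF \<sigma>(1)] cls_above[OF \<sigma>(1) up] T 2 a by auto
          then show ?thesis
            using 2 b \<tau>d \<sigma>(3) \<tau>o[of "(Suc r, x)"] \<tau>o[of "(r, x)"] qtriple_flip_right by auto
        next
          case 3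
          then show ?thesis using b \<tau>o by simp
        qed
        then show ?thesis by (simp add: T quinv_triple_eq[OF sf] quinv_triple_eq[OF sft])
      qed
      have "{T \<in> triples lam. quinv_triple lam \<tau> T} = {T \<in> triples lam. quinv_triple lam \<sigma> T} \<union> ?B"
        using blockB other by blast
      moreover have "{T \<in> triples lam. quinv_triple lam \<sigma> T} \<inter> ?B = {}" using blockB by blast
      moreover have "card ?B = n - 1" using d by (subst card_image) (auto simp: inj_on_def)
      ultimately show ?thesis
        by (simp add: quinv_def card_Un_disjoint finite_triples)
    qed
    have "coinv (Neg a # w) = n - 1 + coinv (Pos a # w)"
    proof -
      have w: "w = map (\<lambda>j. \<sigma> (r, j)) (rev [c..<d])" using \<sigma>(2) by (simp add: word_iff)
      have "big a x" if x: "x \<in> set w" for x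
      proof -
        obtain j where j: "x = \<sigma> (r, j)" "c \<le> j" "j < d" using x by (auto simp: w)
        then have "(r, j) \<in> dg lam" using block_iff[of j] d by auto
        then show ?thesis using cls_big[OF \<sigma>(1)] a j by simp
      qed
      then have "filter (Ind (Neg a)) w = w" "filter (Ind (Pos a)) w = []"
        using Ind_extremal by (auto simp: filter_id_conv filter_empty_conv)
      then show ?thesis using d by (simp add: w)
    qed
    then have "quinv lam \<tau> - coinv (Neg a # w) = quinv lam \<sigma> - coinv (Pos a # w)"
      using qv by simp
    then show ?case unfolding \<tau>_def[symmetric] by (simp add: m p mj del: coinv.simps)
  qed (use cls_flip in \<open>auto simp: word_iff\<close>)
  then show ?thesis by (simp add: word_sum_def sum_negf)
qed

lemma sum_label_row_class_eq_0:
  "(\<Sum>\<sigma>\<in>cls. (- 1) ^ mcount lam \<sigma> * q ^ (pcount lam \<sigma> + maj lam \<sigma>) * t ^ quinv lam \<sigma>) = 0"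
proof -
  \<comment> \<open>Restricting to absolute values from \<open>\<mu>\<close> keeps the alphabet
    finite.\<close>
  define X where "X = Pos ` {b \<in> set_mset \<mu>. a < b} \<union> Neg ` {b \<in> set_mset \<mu>. a < b}"
  let ?A = "insert (Pos a) (insert (Neg a) X)"
  \<comment> \<open>Any word with multiset \<open>K\<close> serves, by
    \<open>word_sum_swap\<close>.\<close>
  define s where "s K = word_sum (SOME w. mset w = K)" for K
  have s: "word_sum w = s (mset w)" for w
  proof -
    have "mset (SOME w'. mset w' = mset w) = mset w" by (rule someI) simp
    then show ?thesis
      unfolding s_def
      by (intro adjacent_swap_invariant_imp_mset_invariant[where f = word_sum, OF word_sum_swap]) simp
  qed
  have finX: "finite X" by (simp add: X_def)
  have word: "word \<sigma> \<in> words ?A n" if "\<sigma> \<in> cls" for \<sigma>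
  proof -
    have "\<sigma> (r, j) \<in> ?A" if "c \<le> j" "j < c + n" for j
    proof -
      have dgj: "(r, j) \<in> dg lam" using block_iff[of j] that by auto
      have "absv (\<sigma> (r, j)) \<in># \<mu>"
        using absv_mem_content[OF dgj, of \<sigma>] \<open>\<sigma> \<in> cls\<close> by (auto simp: label_row_class_def)
      moreover have "big a (\<sigma> (r, j))" using cls_big[OF \<open>\<sigma> \<in> cls\<close> dgj] a by simp
      ultimately show ?thesis by (cases "\<sigma> (r, j)") (auto simp: big_def X_def)
    qed
    then have "(\<lambda>j. \<sigma> (r, j)) ` {c..<c + n} \<subseteq> ?A" unfolding image_subset_iff by simp
    then show ?thesis by (simp add: words_def word_def)
  qed
  have "(\<Sum>\<sigma>\<in>cls. (- 1) ^ mcount lam \<sigma> * q ^ (pcount lam \<sigma> + maj lam \<sigma>) * t ^ quinv lam \<sigma>) =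
     (\<Sum>w\<in>words ?A n. \<Sum>\<sigma>\<in>{\<sigma> \<in> cls. word \<sigma> = w}.
        (- 1) ^ mcount lam \<sigma> * q ^ (pcount lam \<sigma> + maj lam \<sigma>) * t ^ quinv lam \<sigma>)"
    using word finX by (intro sum.group[symmetric] finite_label_row_class finite_words) auto
  also have "\<dots> = (\<Sum>w\<in>words ?A n. t ^ coinv w * s (mset w))"
  proof (intro sum.cong refl)
    fix w
    have "t ^ quinv lam \<sigma> = t ^ coinv w * t ^ (quinv lam \<sigma> - coinv w)"
      if "\<sigma> \<in> {\<sigma> \<in> cls. word \<sigma> = w}" for \<sigma>
      using that coinv_word_le_quinv[of \<sigma>] by (auto simp: cls_super_filling simp flip: power_add)
    then show "(\<Sum>\<sigma>\<in>{\<sigma> \<in> cls. word \<sigma> = w}.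
        (- 1) ^ mcount lam \<sigma> * q ^ (pcount lam \<sigma> + maj lam \<sigma>) * t ^ quinv lam \<sigma>) =
        t ^ coinv w * s (mset w)"
      unfolding s[symmetric] word_sum_def sum_distrib_left
      by (intro sum.cong refl) (simp add: mult_ac)
  qed
  also have "\<dots> = 0"
  proof (rule sum_words_antisymmetric_eq_0)
    have big: "big a x" if "x \<in> ?A" for x using that a by (auto simp: X_def big_def)
    have ne: "absv x \<noteq> a" if "x \<in> X" for x using that by (auto simp: X_def)
    show "\<not> Ind (Pos a) x" "Ind (Neg a) x" if "x \<in> ?A" for x
      using Ind_extremal[OF big[OF that]] by auto
    show "Ind x (Pos a)" "\<not> Ind x (Neg a)" if "x \<in> X" for x
      using Ind_extremal[OF big, of x] that ne by auto
    show "s (add_mset (Neg a) K) = - s (add_mset (Pos a) K)" for K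
    proof -
      obtain w where "K = mset w" by (metis ex_mset)
      then show ?thesis
        using word_sum_flip[of w] s[of "Neg a # w"] s[of "Pos a # w"] by simp
    qed
    show "s K = 0" if "Pos a \<notin># K" "Neg a \<notin># K" for K
    proof -
      obtain w where w: "K = mset w" by (metis ex_mset)
      have "word \<sigma> \<noteq> w" if \<sigma>: "\<sigma> \<in> cls" for \<sigma>
      proof -
        obtain j where j: "(r, j) \<in> dg lam" "ht lam j = r" "absv (\<sigma> (r, j)) = a"
          using \<sigma> by (auto simp: label_row_class_def)
        then have "\<sigma> (r, j) \<in> set (word \<sigma>)" using block_iff[of j] by (auto simp: word_def)
        moreover have "\<sigma> (r, j) = Pos a \<or> \<sigma> (r, j) = Neg a" using j a by (cases "\<sigma> (r, j)") auto
        ultimately show ?thesis using \<open>Pos a \<notin># K\<close> \<open>Neg a \<notin># K\<close> w by auto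
      qed
      then have "{\<sigma> \<in> cls. word \<sigma> = w} = {}" by auto
      then have "word_sum w = 0" unfolding word_sum_def by (simp only: sum.empty)
      then show ?thesis using s w by simp
    qed
  qed (auto simp: finX, auto simp: X_def)
  finally show ?thesis .
qed

end

section \<open>Degenerate fillings as a disjoint union of classes\<close>

definition has_two_columns :: "nat list \<Rightarrow> nat \<Rightarrow> bool" where
  "has_two_columns lam r \<longleftrightarrow> (\<exists>i j. i < j \<and> (r, i) \<in> dg lam \<and> (r, j) \<in> dg lam \<and> ht lam i = r \<and> ht lam j = r)"

lemma phi_degenerate_imp_class:
  assumes "is_partition lam" "super_filling lam \<sigma>" "phi_degenerate lam \<sigma>"
  obtains a r where "0 < a" "a < r" "has_two_columns lam r"
    "\<sigma> \<in> label_row_class lam (content lam \<sigma>) a r"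
proof -
  define a where "a = dist_label lam \<sigma>"
  let ?P = "\<lambda>a. a > 0 \<and> (\<exists>(r, j) \<in> dg lam. absv (\<sigma> (r, j)) = a \<and> r > a)"
  have "\<exists>a. ?P a" using assms(3) by (auto simp: phi_degenerate_def has_dist_label_def)
  then have Pa: "?P a" unfolding a_def dist_label_def by (rule LeastI_ex)
  have least: "a \<le> b" if "?P b" for b unfolding a_def dist_label_def using that by (rule Least_le)
  obtain r j where u: "dist_cell lam \<sigma> (r, j)" "in_degenerate_triple lam (r, j)"
    using assms(3) by (auto simp: phi_degenerate_def)
  have rj: "(r, j) \<in> dg lam" "absv (\<sigma> (r, j)) = a"
    and first: "\<And>v. v \<in> dg lam \<Longrightarrow> absv (\<sigma> v) = a \<Longrightarrow> v \<noteq> (r, j) \<Longrightarrow> reads_before (r, j) v"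
    using u(1) by (auto simp: dist_cell_def a_def)
  obtain i k where ik: "i < k" "(r, i) \<in> dg lam" "(r, k) \<in> dg lam" "ht lam i = r" "j = i \<or> j = k"
    using u(2) by (auto simp: in_degenerate_triple_def)
  \<comment> \<open>The right column of a degenerate triple contains a cell of row \<open>r\<close>
    and is no higher than the left one, so both have height \<open>r\<close>.\<close>
  have "ht lam k \<le> ht lam i" using ik by (intro ht_antimono[OF assms(1)]) (auto simp: dg_def)
  then have hk: "ht lam k = r" using ik by (auto simp: dg_def)
  obtain r' j' where r': "(r', j') \<in> dg lam" "absv (\<sigma> (r', j')) = a" "r' > a" using Pa by auto
  have "r' \<le> r" using first[OF r'(1,2)] by (cases "(r', j') = (r, j)") (auto simp: reads_before_def)
  moreover have "fst v \<le> absv (\<sigma> v)" if "v \<in> dg lam" "absv (\<sigma> v) < a" for v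
    using least[of "absv (\<sigma> v)"] super_filling_nonzero(2)[OF assms(2) that(1)] that
    by (cases v) force
  moreover have "absv (\<sigma> v) \<noteq> a" if "v \<in> dg lam" "r < fst v" for v
    using first[OF that(1)] that(2) by (cases "v = (r, j)") (auto simp: reads_before_def)
  ultimately show ?thesis
    using that[of a r] assms(2) Pa r'(3) ik hk rj
    by (auto simp: label_row_class_def has_two_columns_def)
qed

text \<open>The distinguished cell is the rightmost one in row \<open>r\<close> with absolute value
  \<open>a\<close>. It tops a column of height \<open>r\<close> and forms a degenerate triple with
  another such column. The last two conclusions recover \<open>a\<close> and \<open>r\<close> from
  the filling, so the classes are disjoint.\<close>

lemma class_imp_phi_degenerate:
  assumes "is_partition lam" "0 < a" "a < r" "has_two_columns lam r"
    "\<sigma> \<in> label_row_class lam \<mu> a r"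
  shows "phi_degenerate lam \<sigma>" "dist_label lam \<sigma> = a"
    "\<And>u. dist_cell lam \<sigma> u \<Longrightarrow> fst u = r"
proof -
  have sf: "super_filling lam \<sigma>"
    and low: "\<And>u. u \<in> dg lam \<Longrightarrow> absv (\<sigma> u) < a \<Longrightarrow> fst u \<le> absv (\<sigma> u)"
    and above: "\<And>u. u \<in> dg lam \<Longrightarrow> absv (\<sigma> u) = a \<Longrightarrow> fst u \<le> r"
    using assms(5) by (force simp: label_row_class_def)+
  obtain j0 where j0: "(r, j0) \<in> dg lam" "ht lam j0 = r" "absv (\<sigma> (r, j0)) = a"
    using assms(5) by (auto simp: label_row_class_def)
  have has: "has_dist_label lam \<sigma>"
    using j0 assms(2,3) by (auto simp: has_dist_label_def)
  show lab: "dist_label lam \<sigma> = a"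
    unfolding dist_label_def
  proof (rule Least_equality)
    show "a > 0 \<and> (\<exists>(r, j) \<in> dg lam. absv (\<sigma> (r, j)) = a \<and> r > a)" using j0 assms(2,3) by auto
  next
    fix b assume "b > 0 \<and> (\<exists>(r, j) \<in> dg lam. absv (\<sigma> (r, j)) = b \<and> r > b)"
    then show "a \<le> b" using low by (force simp: not_less[symmetric])
  qed
  define J where "J = {j \<in> row lam r. absv (\<sigma> (r, j)) = a}"
  define j where "j = Max J"
  have J: "finite J" "j0 \<in> J" using j0 finite_row by (auto simp: J_def row_def)
  then have "j \<in> J" "j0 \<le> j" unfolding j_def by (auto intro: Max_in)
  then have rj: "(r, j) \<in> dg lam" "absv (\<sigma> (r, j)) = a" by (auto simp: J_def row_def)
  have "ht lam j \<le> ht lam j0"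
    using \<open>j0 \<le> j\<close> j0 rj by (intro ht_antimono[OF assms(1)]) (auto simp: dg_def)
  then have hj: "ht lam j = r" using j0 rj by (auto simp: dg_def)
  have cell: "dist_cell lam \<sigma> (r, j)"
    unfolding dist_cell_def lab
  proof (intro conjI ballI impI)
    fix v assume v: "v \<in> dg lam" "absv (\<sigma> v) = a" "v \<noteq> (r, j)"
    have "snd v \<le> j" if "fst v = r"
      unfolding j_def using J v that by (intro Max_ge) (auto simp: J_def row_def)
    then show "reads_before (r, j) v"
      using above[OF v(1,2)] v(3) by (cases v) (force simp: reads_before_def)
  qed (use rj in auto)
  obtain x y where xy: "x < y" "(r, x) \<in> dg lam" "(r, y) \<in> dg lam" "ht lam x = r" "ht lam y = r"
    using assms(4) by (auto simp: has_two_columns_def)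
  have "in_degenerate_triple lam (r, j)"
  proof (cases "j < y")
    case True
    then show ?thesis using xy rj hj unfolding in_degenerate_triple_def by blast
  next
    case False
    then have "x < j" using xy by simp
    then show ?thesis using xy rj hj unfolding in_degenerate_triple_def by blast
  qed
  then show "phi_degenerate lam \<sigma>" using has cell by (auto simp: phi_degenerate_def)
  show "fst u = r" if "dist_cell lam \<sigma> u" for u
    using that cell unfolding dist_cell_def reads_before_def
    by (metis fst_conv less_asym')
qed

text \<open>Heights decrease weakly, so the columns of one height are consecutive.\<close>

lemma columns_of_height_interval:
  assumes "is_partition lam" "has_two_columns lam r"
  obtains c n where "0 < n" "\<And>j. (r, j) \<in> dg lam \<and> ht lam j = r \<longleftrightarrow> c \<le> j \<and> j < c + n"
proof -
  define B where "B = {j \<in> row lam r. ht lam j = r}"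
  have B: "finite B" "B \<noteq> {}"
    using assms(2) finite_row by (auto simp: B_def has_two_columns_def row_def)
  define c where "c = Min B"
  define d where "d = Max B"
  have cd: "c \<in> B" "d \<in> B" using B by (auto simp: c_def d_def)
  have bounds: "c \<le> j \<and> j \<le> d" if "j \<in> B" for j using B that by (auto simp: c_def d_def)
  have "j \<in> B" if "c \<le> j" "j \<le> d" for j
  proof -
    have "ht lam d \<le> ht lam j" "ht lam j \<le> ht lam c"
      by (rule ht_antimono[OF assms(1)]; use cd that in \<open>simp add: B_def row_def dg_def\<close>)+
    then show ?thesis using cd that by (auto simp: B_def row_def dg_def)
  qed
  then have "j \<in> B \<longleftrightarrow> c \<le> j \<and> j < c + (Suc d - c)" for j
    using bounds[of j] bounds[OF cd(1)] by auto
  then show ?thesis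
    using that[of "Suc d - c" c] bounds[OF cd(1)] by (auto simp: B_def row_def)
qed

text \<open>Fixing the content \<open>\<mu>\<close> extracts the coefficient of one monomial in the
  variables \<open>x\<close>, which leaves a finite sum.\<close>

theorem mainTheorem12:
  fixes lam :: "nat list" and \<mu> :: "nat multiset" and q t :: "'r :: comm_ring_1"
  assumes "is_partition lam"
  shows "(\<Sum>\<sigma> \<in> {\<sigma>. super_filling lam \<sigma> \<and> phi_degenerate lam \<sigma> \<and> content lam \<sigma> = \<mu>}.
            (-1) ^ mcount lam \<sigma> * q ^ (pcount lam \<sigma> + maj lam \<sigma>) * t ^ quinv lam \<sigma>) = 0"
proof -
  define S where "S = {\<sigma>. super_filling lam \<sigma> \<and> phi_degenerate lam \<sigma> \<and> content lam \<sigma> = \<mu>}"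
  define wt where "wt \<sigma> = (-1) ^ mcount lam \<sigma> * q ^ (pcount lam \<sigma> + maj lam \<sigma>) * t ^ quinv lam \<sigma>" for \<sigma>
  \<comment> \<open>Label and row of the distinguished cell. The choice is harmless, since all
    candidates lie in the same row.\<close>
  define key where "key \<sigma> = (dist_label lam \<sigma>, fst (SOME u. dist_cell lam \<sigma> u))" for \<sigma>
  have finS: "finite S"
    unfolding S_def by (rule finite_subset[OF _ finite_fillings[of lam \<mu>]]) auto
  have key: "\<sigma> \<in> S \<and> key \<sigma> = (a, r)"
    if "0 < a" "a < r" "has_two_columns lam r" "\<sigma> \<in> label_row_class lam \<mu> a r" for \<sigma> a r
  proof -
    note * = class_imp_phi_degenerate[OF assms that]
    have "dist_cell lam \<sigma> (SOME u. dist_cell lam \<sigma> u)"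
      using *(1) by (auto simp: phi_degenerate_def intro: someI)
    then show ?thesis
      using * that(4) by (auto simp: S_def key_def label_row_class_def)
  qed
  have fibre: "(\<Sum>\<sigma>\<in>{\<sigma> \<in> S. key \<sigma> = k}. wt \<sigma>) = 0" if "k \<in> key ` S" for k
  proof -
    obtain \<sigma>0 where \<sigma>0: "\<sigma>0 \<in> S" "k = key \<sigma>0" using \<open>k \<in> key ` S\<close> by auto
    then obtain a r where ar: "0 < a" "a < r" "has_two_columns lam r" "\<sigma>0 \<in> label_row_class lam \<mu> a r"
      using phi_degenerate_imp_class[OF assms, of \<sigma>0] unfolding S_def by blast
    have k: "k = (a, r)" using key[OF ar] \<sigma>0 by simp
    have "\<sigma> \<in> label_row_class lam \<mu> a r" if \<sigma>: "\<sigma> \<in> S" "key \<sigma> = k" for \<sigma>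
    proof -
      obtain a' r' where *: "0 < a'" "a' < r'" "has_two_columns lam r'" "\<sigma> \<in> label_row_class lam \<mu> a' r'"
        using phi_degenerate_imp_class[OF assms, of \<sigma>] \<sigma>(1) unfolding S_def by blast
      then show ?thesis using key[OF *] \<sigma>(2) k by simp
    qed
    \<comment> \<open>The fibres of \<open>key\<close> on \<open>S\<close> are precisely the classes
      treated in the locale \<open>block\<close>.\<close>
    then have eq: "{\<sigma> \<in> S. key \<sigma> = k} = label_row_class lam \<mu> a r" using key[OF ar(1-3)] k by auto
    obtain c n where "0 < n" "\<And>j. (r, j) \<in> dg lam \<and> ht lam j = r \<longleftrightarrow> c \<le> j \<and> j < c + n"
      using columns_of_height_interval[OF assms ar(3)] by metis
    then interpret block lam \<mu> a r c n q t
      using assms ar by unfold_locales auto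
    show ?thesis using sum_label_row_class_eq_0 by (simp add: eq wt_def)
  qed
  have "(\<Sum>\<sigma>\<in>S. wt \<sigma>) = (\<Sum>k\<in>key ` S. \<Sum>\<sigma>\<in>{\<sigma> \<in> S. key \<sigma> = k}. wt \<sigma>)"
    using finS by (intro sum.group[symmetric]) auto
  also have "\<dots> = 0" using fibre by (intro sum.neutral) blast
  finally show ?thesis unfolding S_def wt_def .
qed

end
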